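(* Let $T$ be a Hausdorff locally compact topological inverse semigroup. If $T$ contains the extended bicyclic semigroup $\mathscr{C}_{\mathbb{Z}}$ as a dense subsemigroup and $I=T\setminus{\uparrow}\mathscr{C}_{\mathbb{Z}}\neq\varnothing$, then the following assertions hold: (i) ${\downarrow}e_n$ is a compact subsemilattice in $E(T)$ for every idempotent $e_n=(n,n)\in\mathscr{C}_{\mathbb{Z}}$, $n\in\mathbb{Z}$; (ii) $T\setminus{\uparrow}\mathscr{C}_{\mathbb{Z}}$ is isomorphic to the discrete additive group of integers; (iii) if $\overline{e}$ is a unit of $T\setminus{\uparrow}\mathscr{C}_{\mathbb{Z}}$, then the map $\mathfrak{h}\colon\mathscr{C}_{\mathbb{Z}}\to T\setminus{\uparrow}\mathscr{C}_{\mathbb{Z}}$ defined by the formula $\mathfrak{h}(a,b)=(a,b)\cdot\overline{e}$ is the natural homomorphism generated by the minimal group congruence $\mathfrak{C}_{mg}$ on the semigroup $\mathscr{C}_{\mathbb{Z}}$; (iv) the subsemigroup $S=\mathscr{C}_{\mathbb{Z}}\cup I$ of $T$ is topologically isomorphic to the topological inverse semigroup $(S_3,\tau_3)$.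
   Context: The extended bicyclic semigroup $\mathscr{C}_{\mathbb{Z}}$ is the set $\mathbb{Z}\times\mathbb{Z}$ with the operation $(a,b)\cdot(c,d)=(a-b+c,d)$ if $b<c$; $(a,b)\cdot(c,d)=(a,d)$ if $b=c$; $(a,b)\cdot(c,d)=(a,d+b-c)$ if $b>c$. A topological inverse semigroup is a Hausdorff topological space with a jointly continuous semigroup operation making it an inverse semigroup (each $x$ has a unique $x^{-1}$ with $xx^{-1}x=x$, $x^{-1}xx^{-1}=x^{-1}$) whose inversion $x\mapsto x^{-1}$ is continuous. For $T$ containing $\mathscr{C}_{\mathbb{Z}}$ as a subsemigroup, ${\uparrow}\mathscr{C}_{\mathbb{Z}}=\mathscr{C}_{\mathbb{Z}}\cup\{x\in T\setminus\mathscr{C}_{\mathbb{Z}}\mid \text{there exists } y\in\mathscr{C}_{\mathbb{Z}}\text{ such that }x\cdot y\in\mathscr{C}_{\mathbb{Z}}\}$. $E(T)$ is the semilattice of idempotents of $T$, ordered by $e\leqslant f$ iff $ef=fe=e$, and ${\downarrow}e=\{f\in E(T)\mid f\leqslant e\}$. $\mathfrak{C}_{mg}$ is the least congruence on $\mathscr{C}_{\mathbb{Z}}$ whose quotient is a group; "$\mathfrak{h}$ is the natural homomorphism generated by $\mathfrak{C}_{mg}$" means that $\mathfrak{h}$ is a surjective homomorphism with $\mathfrak{h}(a,b)=\mathfrak{h}(c,d)$ iff $(a,b)\,\mathfrak{C}_{mg}\,(c,d)$ (so that, identifying its target with $\mathscr{C}_{\mathbb{Z}}/\mathfrak{C}_{mg}$,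 it is the quotient map). A topological isomorphism is a semigroup isomorphism which is a homeomorphism. Definition of $(S_3,\tau_3)$: let $G_0=\mathbb{Z}$ be the additive group of integers and $S_3=\mathscr{C}_{\mathbb{Z}}\sqcup G_0$, where the operations on $\mathscr{C}_{\mathbb{Z}}$ and on $G_0$ are the given ones and $(a,b)\cdot n=n\cdot(a,b)=n+b-a\in G_0$ for all $(a,b)\in\mathscr{C}_{\mathbb{Z}}$, $n\in G_0$. For a positive integer $n$ and $k\in G_0$ put $U_n(k)=\{k\}\cup\{(a,a+k)\mid a=n,n+1,n+2,\ldots\}$ if $k\geqslant 0$ and $U_n(k)=\{k\}\cup\{(a-k,a)\mid a=n,n+1,n+2,\ldots\}$ if $k\leqslant 0$. In $\tau_3$ all elements of $\mathscr{C}_{\mathbb{Z}}$ are isolated points, and $\{U_n(k)\mid n\in\mathbb{N}\}$ is a base of $\tau_3$ at $k\in G_0$, where $\mathbb{N}$ is the set of positive integers. *)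

theory Defs
  imports "HOL-Analysis.Analysis" "HOL-Algebra.Group"
begin

section \<open>Semigroups on a carrier set\<close>

definition semigroup_on :: "'a set \<Rightarrow> ('a \<Rightarrow> 'a \<Rightarrow> 'a) \<Rightarrow> bool" where
  "semigroup_on S m \<longleftrightarrow>
     (\<forall>x\<in>S. \<forall>y\<in>S. m x y \<in> S) \<and>
     (\<forall>x\<in>S. \<forall>y\<in>S. \<forall>z\<in>S. m (m x y) z = m x (m y z))"

definition inverse_of :: "('a \<Rightarrow> 'a \<Rightarrow> 'a) \<Rightarrow> 'a \<Rightarrow> 'a \<Rightarrow> bool" where
  "inverse_of m x y \<longleftrightarrow> m (m x y) x = x \<and> m (m y x) y = y"

definition inverse_semigroup_on :: "'a set \<Rightarrow> ('a \<Rightarrow> 'a \<Rightarrow> 'a) \<Rightarrow> bool" where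
  "inverse_semigroup_on S m \<longleftrightarrow>
     semigroup_on S m \<and> (\<forall>x\<in>S. \<exists>!y. y \<in> S \<and> inverse_of m x y)"

definition inversion :: "'a set \<Rightarrow> ('a \<Rightarrow> 'a \<Rightarrow> 'a) \<Rightarrow> 'a \<Rightarrow> 'a" where
  "inversion S m x = (THE y. y \<in> S \<and> inverse_of m x y)"

definition idempotents :: "'a set \<Rightarrow> ('a \<Rightarrow> 'a \<Rightarrow> 'a) \<Rightarrow> 'a set" where
  "idempotents S m = {e \<in> S. m e e = e}"

definition down_set :: "'a set \<Rightarrow> ('a \<Rightarrow> 'a \<Rightarrow> 'a) \<Rightarrow> 'a \<Rightarrow> 'a set" where
  "down_set S m e = {f \<in> idempotents S m. m f e = f \<and> m e f = f}"

definition semilattice_on :: "'a set \<Rightarrow> ('a \<Rightarrow> 'a \<Rightarrow> 'a) \<Rightarrow> bool" where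
  "semilattice_on A m \<longleftrightarrow>
     semigroup_on A m \<and> (\<forall>x\<in>A. m x x = x) \<and> (\<forall>x\<in>A. \<forall>y\<in>A. m x y = m y x)"

definition subsemilattice :: "'a set \<Rightarrow> 'a set \<Rightarrow> ('a \<Rightarrow> 'a \<Rightarrow> 'a) \<Rightarrow> bool" where
  "subsemilattice A E m \<longleftrightarrow> A \<subseteq> E \<and> A \<noteq> {} \<and> semilattice_on A m"

definition identity_on :: "'a set \<Rightarrow> ('a \<Rightarrow> 'a \<Rightarrow> 'a) \<Rightarrow> 'a \<Rightarrow> bool" where
  "identity_on S m e \<longleftrightarrow> e \<in> S \<and> (\<forall>x\<in>S. m e x = x \<and> m x e = x)"


section \<open>Congruences\<close>

definition congruence_on :: "'a set \<Rightarrow> ('a \<Rightarrow> 'a \<Rightarrow> 'a) \<Rightarrow> ('a \<times> 'a) set \<Rightarrow> bool" where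
  "congruence_on S m R \<longleftrightarrow>
     equiv S R \<and> (\<forall>(x, x')\<in>R. \<forall>(y, y')\<in>R. (m x y, m x' y') \<in> R)"

definition quotient_mult ::
    "('a \<Rightarrow> 'a \<Rightarrow> 'a) \<Rightarrow> ('a \<times> 'a) set \<Rightarrow> 'a set \<Rightarrow> 'a set \<Rightarrow> 'a set" where
  "quotient_mult m R X Y = (\<Union>x\<in>X. \<Union>y\<in>Y. R `` {m x y})"

definition group_congruence :: "'a set \<Rightarrow> ('a \<Rightarrow> 'a \<Rightarrow> 'a) \<Rightarrow> ('a \<times> 'a) set \<Rightarrow> bool" where
  "group_congruence S m R \<longleftrightarrow>
     congruence_on S m R \<and>
     (\<exists>e. group \<lparr>carrier = S // R, monoid.mult = quotient_mult m R, one = e\<rparr>)"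

text \<open>The order underlying \<open>LEAST\<close> is inclusion of relations.  For the extended bicyclic
  semigroup a least group congruence exists; see \<open>C_mg_least\<close> below.\<close>

definition min_group_congruence :: "'a set \<Rightarrow> ('a \<Rightarrow> 'a \<Rightarrow> 'a) \<Rightarrow> ('a \<times> 'a) set" where
  "min_group_congruence S m = (LEAST R. group_congruence S m R)"

definition natural_homomorphism ::
    "'a set \<Rightarrow> ('a \<Rightarrow> 'a \<Rightarrow> 'a) \<Rightarrow> ('a \<times> 'a) set \<Rightarrow> 'b set \<Rightarrow> ('b \<Rightarrow> 'b \<Rightarrow> 'b) \<Rightarrow> ('a \<Rightarrow> 'b) \<Rightarrow> bool" where
  "natural_homomorphism S m R S' m' h \<longleftrightarrow>
     h ` S = S' \<and>
     (\<forall>x\<in>S. \<forall>y\<in>S. h (m x y) = m' (h x) (h y)) \<and>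
     (\<forall>x\<in>S. \<forall>y\<in>S. h x = h y \<longleftrightarrow> (x, y) \<in> R)"


section \<open>Topological semigroups\<close>

definition topological_inverse_semigroup :: "'a topology \<Rightarrow> ('a \<Rightarrow> 'a \<Rightarrow> 'a) \<Rightarrow> bool" where
  "topological_inverse_semigroup X m \<longleftrightarrow>
     Hausdorff_space X \<and>
     inverse_semigroup_on (topspace X) m \<and>
     continuous_map (prod_topology X X) X (\<lambda>(x, y). m x y) \<and>
     continuous_map X X (inversion (topspace X) m)"

definition topologically_isomorphic ::
    "'a topology \<Rightarrow> ('a \<Rightarrow> 'a \<Rightarrow> 'a) \<Rightarrow> 'b topology \<Rightarrow> ('b \<Rightarrow> 'b \<Rightarrow> 'b) \<Rightarrow> bool" where
  "topologically_isomorphic X m Y m' \<longleftrightarrow>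
     semigroup_on (topspace X) m \<and> semigroup_on (topspace Y) m' \<and>
     (\<exists>f. homeomorphic_map X Y f \<and>
          (\<forall>x\<in>topspace X. \<forall>y\<in>topspace X. f (m x y) = m' (f x) (f y)))"


section \<open>The extended bicyclic semigroup\<close>

fun cz_mult :: "int \<times> int \<Rightarrow> int \<times> int \<Rightarrow> int \<times> int" where
  "cz_mult (a, b) (c, d) =
     (if b < c then (a - b + c, d) else if b = c then (a, d) else (a, d + b - c))"

abbreviation C_mg :: "((int \<times> int) \<times> (int \<times> int)) set" where
  "C_mg \<equiv> min_group_congruence UNIV cz_mult"

text \<open>\<open>\<iota>\<close> is the inclusion of the extended bicyclic semigroup, so that this semigroup, regarded
  as a subset of the carrier \<open>topspace T\<close>, is \<open>range \<iota>\<close>.\<close>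

definition dense_cz_subsemigroup ::
    "'a topology \<Rightarrow> ('a \<Rightarrow> 'a \<Rightarrow> 'a) \<Rightarrow> (int \<times> int \<Rightarrow> 'a) \<Rightarrow> bool" where
  "dense_cz_subsemigroup T m \<iota> \<longleftrightarrow>
     inj \<iota> \<and> range \<iota> \<subseteq> topspace T \<and>
     (\<forall>p q. \<iota> (cz_mult p q) = m (\<iota> p) (\<iota> q)) \<and>
     T closure_of (range \<iota>) = topspace T"

definition up_cz :: "'a set \<Rightarrow> ('a \<Rightarrow> 'a \<Rightarrow> 'a) \<Rightarrow> (int \<times> int \<Rightarrow> 'a) \<Rightarrow> 'a set" where
  "up_cz S m \<iota> = range \<iota> \<union> {x \<in> S - range \<iota>. \<exists>y\<in>range \<iota>. m x y \<in> range \<iota>}"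


section \<open>The topological inverse semigroup \<open>S\<^sub>3\<close>\<close>

fun s3_mult :: "(int \<times> int) + int \<Rightarrow> (int \<times> int) + int \<Rightarrow> (int \<times> int) + int" where
  "s3_mult (Inl p) (Inl q) = Inl (cz_mult p q)"
| "s3_mult (Inl (a, b)) (Inr n) = Inr (n + b - a)"
| "s3_mult (Inr n) (Inl (a, b)) = Inr (n + b - a)"
| "s3_mult (Inr n) (Inr k) = Inr (n + k)"

text \<open>For \<open>k = 0\<close> the two branches agree.\<close>

definition s3_nbhd :: "nat \<Rightarrow> int \<Rightarrow> ((int \<times> int) + int) set" where
  "s3_nbhd n k =
     (if k \<ge> 0 then {Inr k} \<union> {Inl (a, a + k) | a. int n \<le> a}
      else {Inr k} \<union> {Inl (a - k, a) | a. int n \<le> a})"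

definition tau3 :: "((int \<times> int) + int) topology" where
  "tau3 = topology_generated_by
     (range (\<lambda>p. {Inl p}) \<union> {s3_nbhd n k | n k. 0 < n})"


section \<open>Validation of the definitions\<close>

lemma s3_nbhd_eq:
  "s3_nbhd n k = {Inr k} \<union> {Inl (a, b) | a b. b - a = k \<and> int n \<le> a \<and> int n \<le> b}"
  by (auto simp: s3_nbhd_def)

lemma s3_nbhd_mem:
  "Inl (a, b) \<in> s3_nbhd n k \<longleftrightarrow> b - a = k \<and> int n \<le> a \<and> int n \<le> b"
  "Inr j \<in> s3_nbhd n k \<longleftrightarrow> j = k"
  by (auto simp: s3_nbhd_eq)

lemma topspace_tau3: "topspace tau3 = UNIV"
proof -
  have "x \<in> \<Union>(range (\<lambda>p. {Inl p}) \<union> {s3_nbhd n k | n k. 0 < n})" for x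
  proof (cases x)
    case (Inr k)
    have "Inr k \<in> s3_nbhd 1 k" by (simp add: s3_nbhd_eq)
    then show ?thesis using Inr zero_less_one by blast
  qed auto
  then show ?thesis unfolding tau3_def topology_generated_by_topspace by blast
qed

text \<open>The elements of the extended bicyclic semigroup are isolated, and the sets \<open>s3_nbhd n k\<close>
  with \<open>n > 0\<close> form a base at \<open>Inr k\<close>.\<close>

lemma openin_tau3_iff:
  "openin tau3 W \<longleftrightarrow> (\<forall>k. Inr k \<in> W \<longrightarrow> (\<exists>n>0. s3_nbhd n k \<subseteq> W))"
proof
  assume "openin tau3 W"
  then have "generate_topology_on (range (\<lambda>p. {Inl p}) \<union> {s3_nbhd n k | n k. 0 < n}) W"
    by (simp add: tau3_def openin_topology_generated_by_iff)
  then show "\<forall>k. Inr k \<in> W \<longrightarrow> (\<exists>n>0. s3_nbhd n k \<subseteq> W)"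
  proof (induction rule: generate_topology_on.induct)
    case (Int A B)
    show ?case
    proof (intro allI impI)
      fix k :: int assume "Inr k \<in> A \<inter> B"
      then obtain n1 n2 where "n1 > 0" "n2 > 0" "s3_nbhd n1 k \<subseteq> A" "s3_nbhd n2 k \<subseteq> B"
        using Int by blast
      moreover have "s3_nbhd (max n1 n2) k \<subseteq> s3_nbhd n1 k \<inter> s3_nbhd n2 k"
        by (auto simp: s3_nbhd_eq)
      ultimately show "\<exists>n>0. s3_nbhd n k \<subseteq> A \<inter> B"
        by (intro exI[of _ "max n1 n2"]) auto
    qed
  next
    case (UN K)
    then show ?case by (meson Union_iff Union_upper subset_trans)
  next
    case (Basis s)
    then show ?case by (auto simp: s3_nbhd_eq)
  qed auto
next
  assume W: "\<forall>k. Inr k \<in> W \<longrightarrow> (\<exists>n>0. s3_nbhd n k \<subseteq> W)"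
  have basis: "openin tau3 B" if "B \<in> range (\<lambda>p. {Inl p}) \<union> {s3_nbhd n k | n k. 0 < n}" for B
    using that by (simp add: tau3_def openin_topology_generated_by_iff generate_topology_on.Basis)
  show "openin tau3 W"
  proof (subst openin_subopen, intro ballI)
    fix x assume x: "x \<in> W"
    show "\<exists>B. openin tau3 B \<and> x \<in> B \<and> B \<subseteq> W"
    proof (cases x)
      case (Inl p)
      then show ?thesis using basis[of "{Inl p}"] x by blast
    next
      case (Inr k)
      then obtain n where n: "n > 0" "s3_nbhd n k \<subseteq> W" using W x by blast
      have "Inr k \<in> s3_nbhd n k" by (simp add: s3_nbhd_eq)
      then show ?thesis using basis[of "s3_nbhd n k"] n Inr by blast
    qed
  qed
qed

lemma openin_tau3_Inl: "openin tau3 {Inl p}"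
  by (simp add: openin_tau3_iff)

lemma openin_tau3_nbhd: "n > 0 \<Longrightarrow> openin tau3 (s3_nbhd n k)"
  by (auto simp: openin_tau3_iff s3_nbhd_eq)

lemma cz_mult_assoc: "cz_mult (cz_mult p q) r = cz_mult p (cz_mult q r)"
  by (cases p; cases q; cases r) auto

lemma s3_mult_assoc: "s3_mult (s3_mult x y) z = s3_mult x (s3_mult y z)"
  by (cases x; cases y; cases z) (auto simp: cz_mult_assoc)

fun s3_inv :: "(int \<times> int) + int \<Rightarrow> (int \<times> int) + int" where
  "s3_inv (Inl (a, b)) = Inl (b, a)"
| "s3_inv (Inr n) = Inr (- n)"

lemma s3_inverse_iff: "inverse_of s3_mult x y \<longleftrightarrow> y = s3_inv x"
  by (cases x; cases y) (auto simp: inverse_of_def split: if_splits)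

lemma s3_inversion: "inversion UNIV s3_mult = s3_inv"
  by (auto simp: inversion_def s3_inverse_iff)

lemma s3_mult_nbhd:
  assumes "openin tau3 W" "s3_mult x y \<in> W"
  shows "\<exists>U V. openin tau3 U \<and> openin tau3 V \<and> x \<in> U \<and> y \<in> V \<and>
               (\<forall>u\<in>U. \<forall>v\<in>V. s3_mult u v \<in> W)"
proof (cases x)
  case xl: (Inl p)
  obtain a b where p: "p = (a, b)" by (cases p)
  show ?thesis
  proof (cases y)
    case (Inl q)
    then show ?thesis
      using xl assms
      by (intro exI[of _ "{Inl p}"] exI[of _ "{Inl q}"]) (auto simp: openin_tau3_Inl)
  next
    case (Inr k)
    then obtain n where n: "n > 0" "s3_nbhd n (k + b - a) \<subseteq> W"
      using assms xl p by (auto simp: openin_tau3_iff)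
    define N where "N = n + nat \<bar>a\<bar> + nat \<bar>b\<bar>"
    have "s3_mult (Inl p) v \<in> s3_nbhd n (k + b - a)" if "v \<in> s3_nbhd N k" for v
      using that by (cases v) (auto simp: s3_nbhd_mem p N_def)
    then show ?thesis
      using xl Inr n(1) n(2)
      by (intro exI[of _ "{Inl p}"] exI[of _ "s3_nbhd N k"])
         (auto simp: openin_tau3_Inl N_def intro!: openin_tau3_nbhd, simp add: s3_nbhd_eq)
  qed
next
  case xr: (Inr l)
  show ?thesis
  proof (cases y)
    case (Inl p)
    obtain a b where p: "p = (a, b)" by (cases p)
    obtain n where n: "n > 0" "s3_nbhd n (l + b - a) \<subseteq> W"
      using assms xr p Inl by (auto simp: openin_tau3_iff)
    define N where "N = n + nat \<bar>a\<bar> + nat \<bar>b\<bar>"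
    have "s3_mult u (Inl p) \<in> s3_nbhd n (l + b - a)" if "u \<in> s3_nbhd N l" for u
      using that by (cases u) (auto simp: s3_nbhd_mem p N_def)
    then show ?thesis
      using xr Inl n(1) n(2)
      by (intro exI[of _ "s3_nbhd N l"] exI[of _ "{Inl p}"])
         (auto simp: openin_tau3_Inl N_def intro!: openin_tau3_nbhd, simp add: s3_nbhd_eq)
  next
    case (Inr k)
    then obtain n where n: "n > 0" "s3_nbhd n (l + k) \<subseteq> W"
      using assms xr by (auto simp: openin_tau3_iff)
    have "s3_mult u v \<in> s3_nbhd n (l + k)" if "u \<in> s3_nbhd n l" "v \<in> s3_nbhd n k" for u v
      using that by (cases u; cases v) (auto simp: s3_nbhd_mem)
    moreover have "Inr l \<in> s3_nbhd n l" "Inr k \<in> s3_nbhd n k" by (auto simp: s3_nbhd_eq)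
    ultimately show ?thesis
      unfolding xr Inr
      by (intro exI[of _ "s3_nbhd n l"] exI[of _ "s3_nbhd n k"] conjI ballI
            openin_tau3_nbhd n(1) subsetD[OF n(2)])
  qed
qed

lemma topological_inverse_semigroup_S3: "topological_inverse_semigroup tau3 s3_mult"
proof -
  have H: "Hausdorff_space tau3"
    unfolding Hausdorff_space_def
  proof (intro allI impI)
    fix x y assume "x \<in> topspace tau3 \<and> y \<in> topspace tau3 \<and> x \<noteq> y"
    then have "x \<noteq> y" by simp
    have sep: "\<exists>U V. openin tau3 U \<and> openin tau3 V \<and> Inl p \<in> U \<and> Inr k \<in> V \<and> disjnt U V" for p k
    proof -
      obtain a b where p: "p = (a, b)" by (cases p)
      have "Inl p \<notin> s3_nbhd (1 + nat \<bar>a\<bar>) k" by (auto simp: s3_nbhd_eq p)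
      moreover have "Inr k \<in> s3_nbhd (1 + nat \<bar>a\<bar>) k" by (simp add: s3_nbhd_eq)
      ultimately show ?thesis
        by (intro exI[of _ "{Inl p}"] exI[of _ "s3_nbhd (1 + nat \<bar>a\<bar>) k"])
           (auto simp: openin_tau3_Inl openin_tau3_nbhd)
    qed
    show "\<exists>U V. openin tau3 U \<and> openin tau3 V \<and> x \<in> U \<and> y \<in> V \<and> disjnt U V"
    proof (cases x)
      case xl: (Inl p)
      show ?thesis
      proof (cases y)
        case (Inl q)
        then show ?thesis
          using xl \<open>x \<noteq> y\<close>
          by (intro exI[of _ "{Inl p}"] exI[of _ "{Inl q}"]) (auto simp: openin_tau3_Inl)
      qed (use xl sep in auto)
    next
      case xr: (Inr k)
      show ?thesis
      proof (cases y)
        case (Inl q)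
        then show ?thesis using xr sep[of q k] disjnt_sym by blast
      next
        case (Inr l)
        have "disjnt (s3_nbhd 1 k) (s3_nbhd 1 l)"
          using xr Inr \<open>x \<noteq> y\<close> by (auto simp: disjnt_def s3_nbhd_eq)
        then show ?thesis
          using xr Inr
          by (intro exI[of _ "s3_nbhd 1 k"] exI[of _ "s3_nbhd 1 l"])
             (auto simp: openin_tau3_nbhd, auto simp: s3_nbhd_eq)
      qed
    qed
  qed
  have I: "inverse_semigroup_on UNIV s3_mult"
    by (simp add: inverse_semigroup_on_def semigroup_on_def s3_mult_assoc s3_inverse_iff)
  have M: "continuous_map (prod_topology tau3 tau3) tau3 (\<lambda>(x, y). s3_mult x y)"
    unfolding continuous_map_def
  proof (intro conjI allI impI)
    fix W assume W: "openin tau3 W"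
    show "openin (prod_topology tau3 tau3)
            {z \<in> topspace (prod_topology tau3 tau3). (case z of (x, y) \<Rightarrow> s3_mult x y) \<in> W}"
      unfolding openin_prod_topology_alt
    proof (intro allI impI)
      fix x y
      assume "(x, y) \<in> {z \<in> topspace (prod_topology tau3 tau3). (case z of (x, y) \<Rightarrow> s3_mult x y) \<in> W}"
      then have "s3_mult x y \<in> W" by simp
      from s3_mult_nbhd[OF W this] show "\<exists>U V. openin tau3 U \<and> openin tau3 V \<and> x \<in> U \<and> y \<in> V \<and>
          U \<times> V \<subseteq> {z \<in> topspace (prod_topology tau3 tau3). (case z of (x, y) \<Rightarrow> s3_mult x y) \<in> W}"
        by (fastforce simp: topspace_tau3)
    qed
  qed (simp add: topspace_tau3)
  have V: "continuous_map tau3 tau3 s3_inv"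
    unfolding continuous_map_def
  proof (intro conjI allI impI)
    fix W assume W: "openin tau3 W"
    show "openin tau3 {x \<in> topspace tau3. s3_inv x \<in> W}"
      unfolding openin_tau3_iff
    proof (intro allI impI)
      fix k :: int assume "Inr k \<in> {x \<in> topspace tau3. s3_inv x \<in> W}"
      then obtain n where "n > 0" "s3_nbhd n (- k) \<subseteq> W" using W by (auto simp: openin_tau3_iff)
      then show "\<exists>n>0. s3_nbhd n k \<subseteq> {x \<in> topspace tau3. s3_inv x \<in> W}"
        by (intro exI[of _ n]) (auto simp: s3_nbhd_eq topspace_tau3)
    qed
  qed (simp add: topspace_tau3)
  show ?thesis
    using H I M V by (simp add: topological_inverse_semigroup_def topspace_tau3 s3_inversion)
qed

lemma cz_group_congruence_diff:
  "group_congruence UNIV cz_mult {((a, b), (c, d)). b - a = d - c}"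
proof -
  define R where "R = {((a, b), (c, d :: int)). b - a = d - (c :: int)}"
  define C where "C k = {(a, b :: int). b - a = k}" for k :: int
  have R_iff: "(p, q) \<in> R \<longleftrightarrow> snd p - fst p = snd q - fst q" for p q
    by (cases p; cases q) (simp add: R_def)
  have C_iff: "p \<in> C k \<longleftrightarrow> snd p - fst p = k" for p k
    by (cases p) (simp add: C_def)
  have diff: "snd (cz_mult p q) - fst (cz_mult p q) = (snd p - fst p) + (snd q - fst q)" for p q
    by (cases p; cases q) simp
  have cls: "R `` {p} = C (snd p - fst p)" for p
    by (rule Set.set_eqI) (simp only: Image_singleton_iff R_iff C_iff, metis)
  have eq: "equiv UNIV R"
  proof (rule equivI)
    show "R \<subseteq> UNIV \<times> UNIV" by simp
    show "refl R" by (rule refl_onI) (simp only: R_iff)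
    show "sym R" by (rule symI) (simp only: R_iff)
    show "trans R" by (rule transI) (simp only: R_iff)
  qed
  have cong: "congruence_on UNIV cz_mult R"
    unfolding congruence_on_def
  proof (intro conjI eq ballI, clarify)
    fix a b c d a' b' c' d'
    assume "((a, b), (c, d)) \<in> R" "((a', b'), (c', d')) \<in> R"
    then show "(cz_mult (a, b) (a', b'), cz_mult (c, d) (c', d')) \<in> R"
      unfolding R_iff diff by simp
  qed
  have mem: "(0, k) \<in> C k" for k by (simp add: C_iff)
  have carr: "UNIV // R = range C"
  proof
    show "UNIV // R \<subseteq> range C" unfolding quotient_def using cls by blast
    have "C k = R `` {(0, k)}" for k using cls[of "(0, k)"] by simp
    then show "range C \<subseteq> UNIV // R" unfolding quotient_def by blast
  qed
  have mult: "quotient_mult cz_mult R (C k) (C l) = C (k + l)" for k l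
  proof -
    have *: "R `` {cz_mult p q} = C (k + l)" if "p \<in> C k" "q \<in> C l" for p q
      using that unfolding cls diff by (simp add: C_iff)
    have "quotient_mult cz_mult R (C k) (C l) = (\<Union>p\<in>C k. \<Union>q\<in>C l. C (k + l))"
      unfolding quotient_mult_def by (intro SUP_cong refl *)
    moreover have "C k \<noteq> {}" "C l \<noteq> {}" using mem by blast+
    ultimately show ?thesis by simp
  qed
  have "group \<lparr>carrier = UNIV // R, monoid.mult = quotient_mult cz_mult R, one = C 0\<rparr>"
    unfolding carr
  proof (rule groupI, goal_cases)
    case (1 x y)
    then obtain k l where "x = C k" "y = C l" by auto
    then show ?case by (simp add: mult)
  next
    case 2
    then show ?case by simp
  next
    case (3 x y z)
    then obtain k l j where "x = C k" "y = C l" "z = C j" by auto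
    then show ?case by (simp add: mult add.assoc)
  next
    case (4 x)
    then obtain k where "x = C k" by auto
    then show ?case by (simp add: mult)
  next
    case (5 x)
    then obtain k where "x = C k" by auto
    then show ?case by (intro bexI[of _ "C (- k)"]) (simp_all add: mult)
  qed
  then show ?thesis using cong unfolding group_congruence_def R_def by blast
qed

lemma cz_group_congruence_contains:
  assumes R: "group_congruence UNIV cz_mult R"
  shows "{((a, b), (c, d)). b - a = d - c} \<subseteq> R"
proof -
  have eq: "equiv UNIV R"
    using R unfolding group_congruence_def congruence_on_def by (elim conjE)
  have "\<forall>(x, x')\<in>R. \<forall>(y, y')\<in>R. (cz_mult x y, cz_mult x' y') \<in> R"
    using R unfolding group_congruence_def congruence_on_def by (elim conjE)
  then have cong: "(cz_mult x y, cz_mult x' y') \<in> R" if "(x, x') \<in> R" "(y, y') \<in> R" for x x' y y'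
    using that by fast
  have self: "p \<in> R `` {p}" for p by (rule equiv_class_self[OF eq UNIV_I])
  then have refl: "(p, p) \<in> R" for p by blast
  obtain e where "group \<lparr>carrier = UNIV // R, monoid.mult = quotient_mult cz_mult R, one = e\<rparr>"
    (is "group ?G") using R unfolding group_congruence_def by (elim conjE exE)
  then interpret group ?G .
  have mult: "quotient_mult cz_mult R (R `` {p}) (R `` {q}) = R `` {cz_mult p q}" for p q
  proof -
    have *: "R `` {cz_mult p' q'} = R `` {cz_mult p q}" if "p' \<in> R `` {p}" "q' \<in> R `` {q}" for p' q'
    proof -
      have "(cz_mult p q, cz_mult p' q') \<in> R" using that by (intro cong) blast+
      from equiv_class_eq[OF eq this] show ?thesis by (rule sym)
    qed
    have "quotient_mult cz_mult R (R `` {p}) (R `` {q}) =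
         (\<Union>p'\<in>R `` {p}. \<Union>q'\<in>R `` {q}. R `` {cz_mult p q})"
      unfolding quotient_mult_def by (intro SUP_cong HOL.refl *)
    moreover have "R `` {p} \<noteq> {}" "R `` {q} \<noteq> {}" using self by blast+
    ultimately show ?thesis by (simp only: UN_constant if_False)
  qed
  have one: "R `` {(n, n)} = e" for n
  proof -
    have c: "R `` {(n, n)} \<in> carrier ?G" by (simp add: quotientI)
    have "R `` {(n, n)} \<otimes>\<^bsub>?G\<^esub> R `` {(n, n)} = R `` {(n, n)}" by (simp add: mult)
    with c have "R `` {(n, n)} = \<one>\<^bsub>?G\<^esub>" by (metis l_cancel_one)
    then show ?thesis by simp
  qed
  have idem: "((n, n), (k, k)) \<in> R" for n k
    by (rule eq_equiv_class[OF _ eq UNIV_I]) (simp only: one)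
  have rel: "((a, b), (N, b + N - a)) \<in> R" if "a \<le> N" for a b N
  proof -
    have "cz_mult (a, a) (a, b) = (a, b)" "cz_mult (N, N) (a, b) = (N, b + N - a)"
      using that by auto
    then show ?thesis using cong[OF idem[of a N] refl[of "(a, b)"]] by simp
  qed
  have "((a, b), (c, d)) \<in> R" if "b - a = d - c" for a b c d
  proof -
    have 1: "((a, b), (max a c, b + max a c - a)) \<in> R"
      and 2: "((c, d), (max a c, d + max a c - c)) \<in> R"
      by (rule rel, simp)+
    have "b + max a c - a = d + max a c - c" using that by linarith
    with 1 2 show ?thesis using eq by (metis equivE symD transD)
  qed
  then show ?thesis by auto
qed

lemma C_mg_eq: "C_mg = {((a, b), (c, d)). b - a = d - c}"
  unfolding min_group_congruence_def
  by (rule Least_equality, rule cz_group_congruence_diff, rule cz_group_congruence_contains)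

lemma C_mg_least:
  "group_congruence UNIV cz_mult C_mg"
  "group_congruence UNIV cz_mult R \<Longrightarrow> C_mg \<subseteq> R"
  unfolding C_mg_eq by (rule cz_group_congruence_diff, rule cz_group_congruence_contains)

end

theory Submission
  imports Defs
begin

text \<open>The idea: every element of the extended bicyclic semigroup is isolated in \<open>T\<close>.  An element
  \<open>x\<close> of the ideal \<open>I\<close> can only be approached by \<open>(a, b)\<close> with \<open>a\<close> and \<open>b\<close> tending to infinity,
  because \<open>(n, n) x x\<^sup>-\<^sup>1\<close> lies in \<open>I\<close> for all \<open>n\<close>; hence each \<open>(n, n)\<close> acts as an identity on \<open>I\<close>,
  \<open>I\<close> has just one idempotent \<open>e\<close> and is a group, and \<open>(a, b) e\<close> depends only on \<open>b - a\<close>.  This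
  makes \<open>I\<close> a topological group with a dense cyclic subgroup, the powers of \<open>g = (0, 1) e\<close>.

  Local compactness is used twice, through the fact that a compact neighbourhood \<open>K\<close> of \<open>e\<close> minus
  an open set containing \<open>K \<inter> I\<close> consists of finitely many isolated points.  Applied with the shift
  \<open>x \<mapsto> (1, 0) x (0, 1)\<close>, which fixes \<open>e\<close>, it gives \<open>(k, k) \<longlonglongrightarrow> e\<close>.  If \<open>e\<close> were a limit of positive
  powers of \<open>g\<close>, then the positive powers would be dense in \<open>I\<close>, and almost every point of \<open>K\<close>
  outside \<open>I\<close> could be moved into \<open>K\<close> by some \<open>(0, n)\<close> with \<open>n > 0\<close>; the last point \<open>(j, b)\<close> of \<open>K\<close> in a
  row \<open>j\<close> far out contradicts this.  So \<open>e\<close> is isolated in \<open>I\<close>, and \<open>I\<close> is discrete and infinite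
  cyclic.\<close>

text \<open>For maps that go from the model \<open>Y\<close> into \<open>T\<close>: the inverse
  homeomorphism is again multiplicative, and the semigroup laws of \<open>X\<close> are carried over
  from those of \<open>Y\<close>.\<close>

lemma topologically_isomorphicI:
  assumes Y: "semigroup_on (topspace Y) m'" and h: "homeomorphic_map Y X h"
    and hom: "\<And>x y. x \<in> topspace Y \<Longrightarrow> y \<in> topspace Y \<Longrightarrow> h (m' x y) = m (h x) (h y)"
  shows "topologically_isomorphic X m Y m'"
proof -
  obtain g where g: "homeomorphic_maps Y X h g" using h homeomorphic_map_maps by blast
  then have homeo: "homeomorphic_map X Y g" and gh: "\<And>y. y \<in> topspace Y \<Longrightarrow> g (h y) = y"
    by (auto simp: homeomorphic_maps_map)
  have X: "topspace X = h ` topspace Y" using homeomorphic_imp_surjective_map[OF h] by simp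
  have closed: "m' x y \<in> topspace Y" if "x \<in> topspace Y" "y \<in> topspace Y" for x y
    using Y that by (simp add: semigroup_on_def)
  have assoc: "m' (m' x y) z = m' x (m' y z)"
    if "x \<in> topspace Y" "y \<in> topspace Y" "z \<in> topspace Y" for x y z
    using Y that by (simp add: semigroup_on_def)
  have "semigroup_on (topspace X) m"
    unfolding semigroup_on_def X by (auto simp: closed assoc simp flip: hom)
  moreover have "\<forall>x\<in>topspace X. \<forall>y\<in>topspace X. g (m x y) = m' (g x) (g y)"
    unfolding X by (auto simp: gh closed simp flip: hom)
  ultimately show ?thesis unfolding topologically_isomorphic_def using Y homeo by blast
qed

section \<open>Inversion, continuity and density in \<open>T\<close>\<close>

locale cz_dense =
  fixes T :: "'a topology" and m :: "'a \<Rightarrow> 'a \<Rightarrow> 'a" (infixl "\<cdot>" 70) and \<iota> :: "int \<times> int \<Rightarrow> 'a"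
  assumes top_inv: "topological_inverse_semigroup T m"
    and dense: "dense_cz_subsemigroup T m \<iota>"
begin

definition inv_elem :: "'a \<Rightarrow> 'a" where
  "inv_elem = inversion (topspace T) m"

definition ideal :: "'a set" where
  "ideal = topspace T - up_cz (topspace T) m \<iota>"

lemma Hausdorff: "Hausdorff_space T"
  and inverse_semigroup: "inverse_semigroup_on (topspace T) m"
  and continuous_mult: "continuous_map (prod_topology T T) T (\<lambda>(x, y). x \<cdot> y)"
  and continuous_inv_elem: "continuous_map T T inv_elem"
  using top_inv by (auto simp: topological_inverse_semigroup_def inv_elem_def)

lemma mult_closed [simp]: "x \<in> topspace T \<Longrightarrow> y \<in> topspace T \<Longrightarrow> x \<cdot> y \<in> topspace T"
  and mult_assoc: "x \<in> topspace T \<Longrightarrow> y \<in> topspace T \<Longrightarrow> z \<in> topspace T \<Longrightarrow> x \<cdot> y \<cdot> z = x \<cdot> (y \<cdot> z)"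
  using inverse_semigroup by (auto simp: inverse_semigroup_on_def semigroup_on_def)

lemma inj_iota: "inj \<iota>"
  and iota_closed [simp]: "\<iota> p \<in> topspace T"
  and iota_mult: "\<iota> p \<cdot> \<iota> q = \<iota> (cz_mult p q)"
  and closure_range_iota: "T closure_of (range \<iota>) = topspace T"
  using dense unfolding dense_cz_subsemigroup_def by (blast, blast, metis, blast)

lemma iota_eq_iff [simp]: "\<iota> p = \<iota> q \<longleftrightarrow> p = q"
  using inj_iota by (auto dest: injD)

lemma inv_elem_unique:
  assumes "x \<in> topspace T" "y \<in> topspace T" "inverse_of m x y"
  shows "inv_elem x = y"
  using inverse_semigroup assms unfolding inverse_semigroup_on_def inv_elem_def inversion_def
  by (intro the1_equality) auto

lemma inv_elem_inverse_of:
  assumes "x \<in> topspace T"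
  shows "inv_elem x \<in> topspace T \<and> inverse_of m x (inv_elem x)"
proof -
  have "\<exists>!y. y \<in> topspace T \<and> inverse_of m x y"
    using inverse_semigroup assms unfolding inverse_semigroup_on_def by blast
  then show ?thesis
    unfolding inv_elem_def inversion_def by (rule theI')
qed

lemma inv_elem_closed [simp]: "x \<in> topspace T \<Longrightarrow> inv_elem x \<in> topspace T"
  and inv_elem_left: "x \<in> topspace T \<Longrightarrow> x \<cdot> inv_elem x \<cdot> x = x"
  and inv_elem_right: "x \<in> topspace T \<Longrightarrow> inv_elem x \<cdot> x \<cdot> inv_elem x = inv_elem x"
  using inv_elem_inverse_of by (auto simp: inverse_of_def)

lemma inv_elem_iota [simp]: "inv_elem (\<iota> (a, b)) = \<iota> (b, a)"
  by (rule inv_elem_unique) (auto simp: inverse_of_def iota_mult)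

lemma continuous_map_mult:
  assumes "continuous_map T T f" "continuous_map T T g"
  shows "continuous_map T T (\<lambda>x. f x \<cdot> g x)"
proof -
  have "continuous_map T (prod_topology T T) (\<lambda>x. (f x, g x))"
    using assms by (simp add: continuous_map_pairedI)
  from continuous_map_compose[OF this continuous_mult] show ?thesis
    by (simp add: o_def)
qed

lemma continuous_map_inv_elem:
  assumes "continuous_map T T f"
  shows "continuous_map T T (\<lambda>x. inv_elem (f x))"
  using continuous_map_compose[OF assms continuous_inv_elem] by (simp add: o_def)

lemma continuous_map_ident: "continuous_map T T (\<lambda>x. x)"
  by simp

lemma continuous_map_constant: "c \<in> topspace T \<Longrightarrow> continuous_map T T (\<lambda>x. c)"
  by simp

lemmas continuous_intros_T =
  continuous_map_mult continuous_map_inv_elem continuous_map_ident continuous_map_constant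

lemma openin_preimage:
  assumes "openin T U" "continuous_map T T f"
  shows "openin T {x \<in> topspace T. f x \<in> U}"
  using openin_continuous_map_preimage[OF assms(2,1)] .

lemma closedin_equalizer:
  assumes "continuous_map T T f" "continuous_map T T g"
  shows "closedin T {x \<in> topspace T. f x = g x}"
  using closedin_continuous_maps_eq[OF Hausdorff assms] .

lemma openin_differ:
  assumes "continuous_map T T f" "continuous_map T T g"
  shows "openin T {x \<in> topspace T. f x \<noteq> g x}"
proof -
  have "{x \<in> topspace T. f x \<noteq> g x} = topspace T - {x \<in> topspace T. f x = g x}" by auto
  then show ?thesis using closedin_equalizer[OF assms] by auto
qed

lemma open_meets_range_iota:
  assumes "openin T U" "x \<in> U"
  obtains a b where "\<iota> (a, b) \<in> U"
proof -
  have "x \<in> T closure_of (range \<iota>)"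
    using closure_range_iota openin_subset[OF assms(1)] assms(2) by auto
  then show ?thesis using assms that unfolding in_closure_of by fastforce
qed

text \<open>By density, a nonempty open set \<open>U - F\<close> would contain a pair. Later
  arguments use this to check an implication from an open to a closed condition on pairs of integers
  only.\<close>

lemma open_subset_closed:
  assumes "openin T U" "closedin T F" "\<And>a b. \<iota> (a, b) \<in> U \<Longrightarrow> \<iota> (a, b) \<in> F"
  shows "U \<subseteq> F"
proof
  fix x assume "x \<in> U"
  show "x \<in> F"
  proof (rule ccontr)
    assume "x \<notin> F"
    then have "x \<in> U - F" using \<open>x \<in> U\<close> by blast
    moreover have "openin T (U - F)" using assms(1,2) by (rule openin_diff)
    ultimately show False using open_meets_range_iota assms(3) by blast
  qed
qed

lemma closedin_singleton: "x \<in> topspace T \<Longrightarrow> closedin T {x}"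
  by (simp add: closedin_Hausdorff_sing_eq Hausdorff)

text \<open>By density and the Hausdorff property it suffices to find an open set of \<open>T\<close> that meets the
  extended bicyclic semigroup in the given point only.\<close>

lemma openin_iota: "openin T {\<iota> p}"
proof -
  obtain a b where p: "p = (a, b)" by (cases p)
  have sub: "W \<subseteq> {\<iota> q}" if "openin T W" "\<And>c d. \<iota> (c, d) \<in> W \<Longrightarrow> (c, d) = q" for W q
    by (rule open_subset_closed[OF that(1) closedin_singleton]) (simp, drule that(2), simp)
  \<comment> \<open>On pairs the first two conditions say that compression by \<open>(n, n)\<close>
    yields \<open>(n, n)\<close>, that is, \<open>x = (a, a)\<close> with \<open>a \<le> n\<close>;
    the third excludes \<open>a < n\<close>.\<close>
  define V where "V n = {x \<in> topspace T. \<iota> (n, n) \<cdot> x \<cdot> \<iota> (n, n) \<noteq> \<iota> (n + 1, n + 1) \<cdot> (\<iota> (n, n) \<cdot> x \<cdot> \<iota> (n, n))} \<inter>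
     {x \<in> topspace T. \<iota> (n, n) \<cdot> x \<cdot> \<iota> (n, n) \<noteq> \<iota> (n, n) \<cdot> x \<cdot> \<iota> (n, n) \<cdot> \<iota> (n + 1, n + 1)} \<inter>
     {x \<in> topspace T. x \<cdot> \<iota> (n - 1, n - 1) \<noteq> \<iota> (n - 1, n - 1)}" for n
  have openV: "openin T (V n)" for n
    unfolding V_def by (intro openin_Int openin_differ continuous_intros_T iota_closed)
  have "V n \<subseteq> {\<iota> (n, n)}" for n
    by (rule sub[OF openV]) (auto simp: V_def iota_mult split: if_splits)
  moreover have "\<iota> (n, n) \<in> V n" for n by (auto simp: V_def iota_mult)
  ultimately have V: "V n = {\<iota> (n, n)}" for n by blast
  \<comment> \<open>On pairs the first condition leaves the \<open>(s, t)\<close> on the diagonal of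
    \<open>(a, b)\<close> with \<open>t \<le> b\<close>; the second excludes
    \<open>t < b\<close>.\<close>
  define W where "W = {x \<in> topspace T. x \<cdot> \<iota> (b, a) \<in> V a} \<inter>
     {x \<in> topspace T. x \<cdot> \<iota> (b - 1, b - 1) \<noteq> \<iota> (a - 1, b - 1)}"
  have openW: "openin T W"
    unfolding W_def
    by (intro openin_Int openin_differ openin_preimage openV continuous_intros_T iota_closed)
  have "W \<subseteq> {\<iota> (a, b)}"
    by (rule sub[OF openW]) (auto simp: W_def V iota_mult split: if_splits)
  moreover have "\<iota> (a, b) \<in> W" by (auto simp: W_def V iota_mult)
  ultimately have "W = {\<iota> p}" using p by blast
  then show ?thesis using openW by simp
qed

lemma openin_iota_image: "openin T (\<iota> ` A)"
proof -
  have "openin T (\<Union>p\<in>A. {\<iota> p})" using openin_iota by blast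
  moreover have "(\<Union>p\<in>A. {\<iota> p}) = \<iota> ` A" by auto
  ultimately show ?thesis by simp
qed

section \<open>The ideal and its position in \<open>T\<close>\<close>

lemma mem_ideal_iff:
  "x \<in> ideal \<longleftrightarrow> x \<in> topspace T \<and> (\<forall>p. x \<cdot> \<iota> p \<notin> range \<iota>)"
proof -
  have "\<iota> q \<cdot> \<iota> p \<in> range \<iota>" for p q by (simp add: iota_mult)
  then show ?thesis unfolding ideal_def up_cz_def by blast
qed

lemma ideal_closed [simp]: "x \<in> ideal \<Longrightarrow> x \<in> topspace T"
  by (simp add: mem_ideal_iff)

lemma iota_notin_ideal [simp]: "\<iota> p \<notin> ideal"
  by (simp add: mem_ideal_iff iota_mult)

text \<open>As \<open>range \<iota>\<close> is open, a product
  \<open>x \<cdot> t \<cdot> \<iota> p\<close> in it stays there when \<open>t\<close> is replaced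
  by a nearby pair, which contradicts \<open>x \<in> ideal\<close>.\<close>

lemma ideal_mult_right:
  assumes "x \<in> ideal" "t \<in> topspace T"
  shows "x \<cdot> t \<in> ideal"
proof (rule ccontr)
  assume "x \<cdot> t \<notin> ideal"
  then obtain p where p: "x \<cdot> t \<cdot> \<iota> p \<in> range \<iota>" using assms by (auto simp: mem_ideal_iff)
  define U where "U = {s \<in> topspace T. x \<cdot> s \<cdot> \<iota> p \<in> range \<iota>}"
  have "openin T U" unfolding U_def
    using assms by (intro openin_preimage openin_iota_image continuous_intros_T iota_closed ideal_closed)
  moreover have "t \<in> U" using p assms by (simp add: U_def)
  ultimately obtain a b where "\<iota> (a, b) \<in> U" using open_meets_range_iota by blast
  then have "x \<cdot> \<iota> (cz_mult (a, b) p) \<in> range \<iota>"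
    using assms by (simp add: U_def mult_assoc iota_mult)
  then show False using assms(1) unfolding mem_ideal_iff by blast
qed

text \<open>\<open>up_cz\<close> mentions right multiples only; this supplies the left-right
  symmetry. For pairs, \<open>p s = (d1, d2)\<close> forces
  \<open>s (d2, d2) = (d1 + c2 - c1, d2)\<close>, and density extends this to
  \<open>x\<close>.\<close>

lemma iota_mult_left_imp_right:
  assumes x: "x \<in> topspace T" and d: "\<iota> p \<cdot> x \<in> range \<iota>"
  shows "\<exists>q. x \<cdot> \<iota> q \<in> range \<iota>"
proof -
  obtain c1 c2 where p: "p = (c1, c2)" by (cases p)
  obtain d1 d2 where d: "\<iota> p \<cdot> x = \<iota> (d1, d2)" using d by auto
  have "{s \<in> topspace T. \<iota> p \<cdot> s \<in> {\<iota> (d1, d2)}} \<subseteq>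
      {s \<in> topspace T. s \<cdot> \<iota> (d2, d2) = \<iota> (d1 + c2 - c1, d2)}"
    by (intro open_subset_closed openin_preimage openin_iota closedin_equalizer
        continuous_intros_T iota_closed) (auto simp: p iota_mult split: if_splits)
  then have "x \<cdot> \<iota> (d2, d2) = \<iota> (d1 + c2 - c1, d2)" using x d by blast
  then show ?thesis by blast
qed

lemma ideal_mult_left:
  assumes "x \<in> ideal" "t \<in> topspace T"
  shows "t \<cdot> x \<in> ideal"
proof (rule ccontr)
  assume "t \<cdot> x \<notin> ideal"
  then obtain p where p: "t \<cdot> x \<cdot> \<iota> p \<in> range \<iota>" using assms by (auto simp: mem_ideal_iff)
  define U where "U = {s \<in> topspace T. s \<cdot> x \<cdot> \<iota> p \<in> range \<iota>}"
  have "openin T U" unfolding U_def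
    using assms by (intro openin_preimage openin_iota_image continuous_intros_T iota_closed ideal_closed)
  moreover have "t \<in> U" using p assms by (simp add: U_def)
  ultimately obtain a b where "\<iota> (a, b) \<in> U" using open_meets_range_iota by blast
  then have "\<iota> (a, b) \<cdot> (x \<cdot> \<iota> p) \<in> range \<iota>"
    using assms by (simp add: U_def mult_assoc)
  then obtain q where "x \<cdot> \<iota> p \<cdot> \<iota> q \<in> range \<iota>"
    using iota_mult_left_imp_right assms by (meson ideal_closed iota_closed mult_closed)
  then have "x \<cdot> \<iota> (cz_mult p q) \<in> range \<iota>"
    using assms by (simp add: mult_assoc iota_mult)
  then show False using assms(1) unfolding mem_ideal_iff by blast
qed

lemma inv_elem_ideal: "x \<in> ideal \<Longrightarrow> inv_elem x \<in> ideal"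
  by (metis ideal_closed ideal_mult_left ideal_mult_right inv_elem_closed inv_elem_right)

text \<open>On the extended bicyclic semigroup the two conditions say that \<open>a > n\<close> and \<open>b > n\<close>
  for \<open>x = (a, b)\<close>.\<close>

definition tail :: "int \<Rightarrow> 'a set" where
  "tail n = {x \<in> topspace T. \<iota> (n, n) \<cdot> (x \<cdot> inv_elem x) \<noteq> \<iota> (n, n)} \<inter>
            {x \<in> topspace T. \<iota> (n, n) \<cdot> (inv_elem x \<cdot> x) \<noteq> \<iota> (n, n)}"

text \<open>The local submonoid \<open>(n, n) T (n, n)\<close>, written as a fixed point set so that
  it is visibly closed.\<close>

definition corner :: "int \<Rightarrow> 'a set" where
  "corner n = {x \<in> topspace T. \<iota> (n, n) \<cdot> x \<cdot> \<iota> (n, n) = x}"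

lemma openin_tail: "openin T (tail n)"
  unfolding tail_def by (intro openin_Int openin_differ continuous_intros_T iota_closed)

lemma closedin_corner: "closedin T (corner n)"
  unfolding corner_def by (intro closedin_equalizer continuous_intros_T iota_closed)

lemma iota_in_tail_iff [simp]: "\<iota> (a, b) \<in> tail n \<longleftrightarrow> n < a \<and> n < b"
  by (auto simp: tail_def iota_mult)

lemma iota_in_corner_iff [simp]: "\<iota> (a, b) \<in> corner n \<longleftrightarrow> n \<le> a \<and> n \<le> b"
  by (auto simp: corner_def iota_mult)

text \<open>Products with a factor in the ideal stay in it and hence differ from
  \<open>(n, n)\<close>.\<close>

lemma ideal_subset_tail: "ideal \<subseteq> tail n"
proof
  fix x assume x: "x \<in> ideal"
  then have "\<iota> (n, n) \<cdot> (x \<cdot> inv_elem x) \<in> ideal" "\<iota> (n, n) \<cdot> (inv_elem x \<cdot> x) \<in> ideal"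
    by (simp_all add: ideal_mult_left ideal_mult_right)
  then have "\<iota> (n, n) \<cdot> (x \<cdot> inv_elem x) \<noteq> \<iota> (n, n)" "\<iota> (n, n) \<cdot> (inv_elem x \<cdot> x) \<noteq> \<iota> (n, n)"
    by (metis iota_notin_ideal)+
  then show "x \<in> tail n" using x by (simp add: tail_def)
qed

lemma tail_subset_corner: "tail n \<subseteq> corner n"
  by (intro open_subset_closed openin_tail closedin_corner) auto

text \<open>The ideal lies in every \<open>corner n\<close>; absorbing the idempotent
  \<open>(n, n)\<close> splits the two-sided identity into one-sided ones.\<close>

lemma ideal_iota_idem:
  assumes "x \<in> ideal"
  shows "\<iota> (n, n) \<cdot> x = x" "x \<cdot> \<iota> (n, n) = x"
proof -
  have x: "\<iota> (n, n) \<cdot> x \<cdot> \<iota> (n, n) = x"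
    using assms ideal_subset_tail tail_subset_corner by (fastforce simp: corner_def)
  have i: "\<iota> (n, n) \<cdot> \<iota> (n, n) = \<iota> (n, n)" by (simp add: iota_mult)
  have "\<iota> (n, n) \<cdot> x = \<iota> (n, n) \<cdot> (\<iota> (n, n) \<cdot> x \<cdot> \<iota> (n, n))" by (simp add: x)
  also have "\<dots> = (\<iota> (n, n) \<cdot> \<iota> (n, n)) \<cdot> x \<cdot> \<iota> (n, n)" using assms by (simp add: mult_assoc)
  finally show "\<iota> (n, n) \<cdot> x = x" by (simp add: i x)
  have "x \<cdot> \<iota> (n, n) = \<iota> (n, n) \<cdot> x \<cdot> \<iota> (n, n) \<cdot> \<iota> (n, n)" by (simp add: x)
  also have "\<dots> = \<iota> (n, n) \<cdot> x \<cdot> (\<iota> (n, n) \<cdot> \<iota> (n, n))" using assms by (simp add: mult_assoc)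
  finally show "x \<cdot> \<iota> (n, n) = x" by (simp add: i x)
qed

text \<open>The set \<open>up_cz\<close> may have points outside \<open>range \<iota>\<close>, but
  none of them lies in a corner: a corner point outside the ideal is confined to a finite set of
  pairs.\<close>

lemma corner_subset: "corner n \<subseteq> range \<iota> \<union> ideal"
proof
  fix x assume x: "x \<in> corner n"
  then have xT: "x \<in> topspace T" by (simp add: corner_def)
  show "x \<in> range \<iota> \<union> ideal"
  proof (cases "x \<in> ideal")
    case False
    then obtain c k d1 d2 where d: "x \<cdot> \<iota> (c, k) = \<iota> (d1, d2)"
      using xT unfolding mem_ideal_iff by fastforce
    define D where "D = d2 - d1 + c - k"
    \<comment> \<open>Pairs solving \<open>(a, b) (c, k) = (d1, d2)\<close> lie on the diagonal
      \<open>D\<close> with \<open>a \<le> d1\<close>, so compression by \<open>(n, n)\<close> takes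
      them into this finite segment. The least first coordinate on that diagonal within the corner
      is \<open>max n (n - D)\<close>.\<close>
    define B where "B = (\<lambda>i. (i, i + D)) ` {n..max d1 (max n (n - D))}"
    have "closedin T (\<iota> ` B)"
      by (simp add: B_def closedin_Hausdorff_finite[OF Hausdorff] image_subset_iff)
    then have cl: "closedin T {s \<in> topspace T. \<iota> (n, n) \<cdot> s \<cdot> \<iota> (n, n) \<in> \<iota> ` B}"
      by (rule closedin_continuous_map_preimage[rotated])
        (intro continuous_intros_T iota_closed)
    have B: "cz_mult (cz_mult (n, n) (a, b)) (n, n) \<in> B"
      if "cz_mult (a, b) (c, k) = (d1, d2)" for a b
    proof -
      have 1: "b - a = D" "a \<le> d1" using that by (auto simp: D_def split: if_splits)
      have 2: "cz_mult (cz_mult (n, n) (a, b)) (n, n) = (max a (max n (n - D)), max a (max n (n - D)) + D)"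
        using 1(1) by (auto simp: max_def)
      show ?thesis using 1(2) unfolding 2 B_def
        by (intro image_eqI[OF refl]) (auto simp: le_max_iff_disj)
    qed
    have "{s \<in> topspace T. s \<cdot> \<iota> (c, k) \<in> {\<iota> (d1, d2)}} \<subseteq>
        {s \<in> topspace T. \<iota> (n, n) \<cdot> s \<cdot> \<iota> (n, n) \<in> \<iota> ` B}"
    proof (rule open_subset_closed[OF _ cl])
      fix a b assume "\<iota> (a, b) \<in> {s \<in> topspace T. s \<cdot> \<iota> (c, k) \<in> {\<iota> (d1, d2)}}"
      then have "cz_mult (a, b) (c, k) = (d1, d2)" by (simp add: iota_mult)
      then show "\<iota> (a, b) \<in> {s \<in> topspace T. \<iota> (n, n) \<cdot> s \<cdot> \<iota> (n, n) \<in> \<iota> ` B}"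
        using B by (simp only: iota_mult mem_Collect_eq iota_closed) blast
    qed (intro openin_preimage openin_iota continuous_intros_T iota_closed)
    then have "\<iota> (n, n) \<cdot> x \<cdot> \<iota> (n, n) \<in> \<iota> ` B" using xT d by blast
    then show ?thesis using x by (auto simp: corner_def)
  qed auto
qed

text \<open>\<open>K - V\<close> is compact and, by \<open>corner_subset\<close>, consists of
  isolated pairs, so finitely many singletons cover it.\<close>

lemma compact_minus_open_finite:
  assumes "compactin T K" "openin T V" "K \<subseteq> corner n" "K \<inter> ideal \<subseteq> V"
  shows "finite {p. \<iota> p \<in> K - V}"
proof -
  have "K - V = K \<inter> (topspace T - V)" using compactin_subset_topspace[OF assms(1)] by blast
  then have comp: "compactin T (K - V)"
    using compact_Int_closedin[OF assms(1), of "topspace T - V"] assms(2) by auto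
  have "K - V \<subseteq> \<Union>(range (\<lambda>p. {\<iota> p}))" using assms(3,4) corner_subset[of n] by blast
  moreover have "\<forall>U\<in>range (\<lambda>p. {\<iota> p}). openin T U" using openin_iota by blast
  ultimately obtain F where F: "finite F" "F \<subseteq> range (\<lambda>p. {\<iota> p})" "K - V \<subseteq> \<Union>F"
    using comp unfolding compactin_def by meson
  have "finite (\<Union>F)" using F(1,2) by auto
  then have "finite (K - V)" using F(3) finite_subset by blast
  then have "finite (\<iota> -` (K - V))" by (rule finite_vimageI) (rule inj_iota)
  then show ?thesis by (simp add: vimage_def)
qed

end

section \<open>The group structure of the ideal\<close>

locale cz_closure = cz_dense +
  assumes locally_compact: "locally_compact_space T"
    and ideal_nonempty: "ideal \<noteq> {}"
begin

text \<open>The choice is harmless: \<open>idem_in_ideal_iff\<close> shows that the ideal has only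
  one idempotent.\<close>

definition ebar :: 'a where
  "ebar = (SOME e. e \<in> ideal \<and> e \<cdot> e = e)"

lemma ebar_ideal [simp]: "ebar \<in> ideal"
  and ebar_idem [simp]: "ebar \<cdot> ebar = ebar"
proof -
  obtain x where x: "x \<in> ideal" using ideal_nonempty by blast
  have "x \<cdot> inv_elem x \<cdot> (x \<cdot> inv_elem x) = x \<cdot> inv_elem x \<cdot> x \<cdot> inv_elem x"
    using x by (simp add: mult_assoc)
  also have "\<dots> = x \<cdot> inv_elem x" using x by (simp add: inv_elem_left)
  finally have "\<exists>e. e \<in> ideal \<and> e \<cdot> e = e" using x ideal_mult_right by (meson ideal_closed inv_elem_closed)
  then have "ebar \<in> ideal \<and> ebar \<cdot> ebar = ebar" unfolding ebar_def by (rule someI_ex)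
  then show "ebar \<in> ideal" "ebar \<cdot> ebar = ebar" by auto
qed

lemma inv_elem_idem: "e \<in> topspace T \<Longrightarrow> e \<cdot> e = e \<Longrightarrow> inv_elem e = e"
  by (rule inv_elem_unique) (auto simp: inverse_of_def)

text \<open>An idempotent need not be known as a limit of idempotent pairs, so density is applied to
  \<open>x \<cdot> inv_elem x\<close>, which is \<open>(a, a)\<close> at a pair
  \<open>(a, b)\<close> and equals \<open>f\<close> at \<open>x = f\<close>.\<close>

lemma ideal_mult_idem:
  assumes "g \<in> ideal" "f \<in> topspace T" "f \<cdot> f = f"
  shows "g \<cdot> f = g" "f \<cdot> g = g"
proof -
  have "topspace T \<subseteq> {x \<in> topspace T. g \<cdot> (x \<cdot> inv_elem x) = g}"
    using assms
    by (intro open_subset_closed openin_topspace closedin_equalizer continuous_intros_T ideal_closed)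
      (auto simp: iota_mult ideal_iota_idem)
  then have "g \<cdot> (f \<cdot> inv_elem f) = g" using assms by blast
  then show "g \<cdot> f = g" using assms by (simp add: inv_elem_idem)
  have "topspace T \<subseteq> {x \<in> topspace T. (x \<cdot> inv_elem x) \<cdot> g = g}"
    using assms
    by (intro open_subset_closed openin_topspace closedin_equalizer continuous_intros_T ideal_closed)
      (auto simp: iota_mult ideal_iota_idem)
  then have "f \<cdot> inv_elem f \<cdot> g = g" using assms by blast
  then show "f \<cdot> g = g" using assms by (simp add: inv_elem_idem)
qed

lemma ebar_closed [simp]: "ebar \<in> topspace T"
  by (rule ideal_closed) simp

lemma ebar_unit [simp]: "x \<in> ideal \<Longrightarrow> ebar \<cdot> x = x" "x \<in> ideal \<Longrightarrow> x \<cdot> ebar = x"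
  by (rule ideal_mult_idem; simp)+

lemma idem_in_ideal_iff: "e \<in> ideal \<Longrightarrow> e \<cdot> e = e \<longleftrightarrow> e = ebar"
  using ideal_mult_idem(1)[OF ebar_ideal, of e] by auto

lemma ideal_inverse:
  assumes "x \<in> ideal"
  shows "x \<cdot> inv_elem x = ebar" "inv_elem x \<cdot> x = ebar"
proof -
  have "x \<cdot> inv_elem x \<in> ideal" using assms by (auto intro: ideal_mult_right)
  moreover have "x \<cdot> inv_elem x \<cdot> (x \<cdot> inv_elem x) = x \<cdot> inv_elem x \<cdot> x \<cdot> inv_elem x"
    using assms by (simp add: mult_assoc)
  ultimately show "x \<cdot> inv_elem x = ebar"
    using assms idem_in_ideal_iff by (simp add: inv_elem_left)
  have "inv_elem x \<cdot> x \<in> ideal" using assms by (auto intro: ideal_mult_left)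
  moreover have "inv_elem x \<cdot> x \<cdot> (inv_elem x \<cdot> x) = inv_elem x \<cdot> x \<cdot> inv_elem x \<cdot> x"
    using assms by (simp add: mult_assoc)
  ultimately show "inv_elem x \<cdot> x = ebar"
    using assms idem_in_ideal_iff by (simp add: inv_elem_right)
qed

text \<open>Both sides lie in the ideal, where \<open>ebar\<close> is a unit, so both equal
  \<open>ebar \<cdot> t \<cdot> ebar\<close>.\<close>

lemma ebar_central:
  assumes "t \<in> topspace T"
  shows "ebar \<cdot> t = t \<cdot> ebar"
proof -
  have "ebar \<cdot> t = ebar \<cdot> t \<cdot> ebar" "t \<cdot> ebar = ebar \<cdot> (t \<cdot> ebar)"
    using assms by (simp_all add: ideal_mult_left ideal_mult_right)
  then show ?thesis using assms by (simp add: mult_assoc)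
qed

text \<open>The \<open>k\<close>-th power of the generator \<open>g\<close>.\<close>

definition pw :: "int \<Rightarrow> 'a" where
  "pw k = \<iota> (0, k) \<cdot> ebar"

text \<open>Since \<open>(N, N)\<close> acts trivially on the ideal, \<open>(a, b)\<close> may be
  slid up its diagonal to \<open>(N, N + b - a)\<close>; pairs on the same diagonal meet
  there.\<close>

lemma iota_mult_ebar: "\<iota> (a, b) \<cdot> ebar = pw (b - a)"
proof -
  have *: "\<iota> (a, b) \<cdot> ebar = \<iota> (N, N + b - a) \<cdot> ebar" if "a \<le> N" for a b N
  proof -
    have "\<iota> (a, b) \<cdot> ebar = \<iota> (N, N) \<cdot> (\<iota> (a, b) \<cdot> ebar)"
      by (simp add: ideal_iota_idem ideal_mult_left)
    also have "\<dots> = \<iota> (cz_mult (N, N) (a, b)) \<cdot> ebar" by (simp add: iota_mult flip: mult_assoc)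
    also have "cz_mult (N, N) (a, b) = (N, N + b - a)" using that by auto
    finally show ?thesis .
  qed
  show ?thesis using *[of a "max a 0" b] *[of 0 "max a 0" "b - a"] by (simp add: pw_def algebra_simps)
qed

lemma pw_ideal [simp]: "pw k \<in> ideal"
  by (simp add: pw_def ideal_mult_left)

lemma pw_closed [simp]: "pw k \<in> topspace T"
  by (rule ideal_closed) simp

lemma pw_0 [simp]: "pw 0 = ebar"
  by (simp add: pw_def ideal_iota_idem)

lemma iota_mult_pw: "\<iota> (a, b) \<cdot> pw k = pw (k + b - a)"
proof -
  obtain c d where cd: "cz_mult (a, b) (0, k) = (c, d)" "d - c = k + b - a"
    by (cases "b < 0"; cases "b = 0") auto
  have "\<iota> (a, b) \<cdot> pw k = \<iota> (cz_mult (a, b) (0, k)) \<cdot> ebar"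
    by (simp add: pw_def iota_mult flip: mult_assoc)
  then show ?thesis by (simp only: cd iota_mult_ebar)
qed

lemma ideal_mult_iota:
  assumes "y \<in> ideal"
  shows "y \<cdot> \<iota> (a, b) = y \<cdot> pw (b - a)"
proof -
  have "y \<cdot> \<iota> (a, b) = y \<cdot> \<iota> (a, b) \<cdot> ebar" using assms by (simp add: ideal_mult_right)
  then show ?thesis using assms by (simp add: mult_assoc iota_mult_ebar)
qed

lemma pw_add: "pw k \<cdot> pw l = pw (k + l)"
proof -
  have "pw k \<cdot> pw l = \<iota> (0, k) \<cdot> (ebar \<cdot> pw l)" by (simp add: pw_def[of k] mult_assoc)
  then show ?thesis by (simp add: iota_mult_pw add.commute)
qed

text \<open>Multiplication by \<open>ebar\<close> retracts \<open>T\<close> onto the ideal and sends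
  pairs to powers, so the powers are dense in the ideal.\<close>

lemma ideal_open_contains_pw:
  assumes "openin T U" "x \<in> U" "x \<in> ideal"
  obtains k where "pw k \<in> U"
proof -
  have "openin T {y \<in> topspace T. y \<cdot> ebar \<in> U}"
    using assms by (intro openin_preimage continuous_intros_T) auto
  moreover have "x \<in> {y \<in> topspace T. y \<cdot> ebar \<in> U}" using assms by simp
  ultimately obtain a b where "\<iota> (a, b) \<cdot> ebar \<in> U" using open_meets_range_iota by blast
  then show ?thesis using that by (simp add: iota_mult_ebar)
qed

section \<open>Convergence along the diagonals\<close>

lemma ebar_compact_nbhd:
  obtains W K where "openin T W" "compactin T K" "ebar \<in> W" "W \<subseteq> K" "K \<subseteq> corner 0"
proof -
  obtain U K where UK: "openin T U" "compactin T K" "ebar \<in> U" "U \<subseteq> K"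
    using locally_compact ebar_closed unfolding locally_compact_space_def by blast
  show ?thesis
  proof
    \<comment> \<open>Cutting down to the corner makes \<open>compact_minus_open_finite\<close>
      applicable.\<close>
    show "openin T (U \<inter> tail 0)" using UK(1) openin_tail by (rule openin_Int)
    show "compactin T (K \<inter> corner 0)" using UK(2) closedin_corner by (rule compact_Int_closedin)
    show "ebar \<in> U \<inter> tail 0" using UK(3) ideal_subset_tail ebar_ideal by blast
    show "U \<inter> tail 0 \<subseteq> K \<inter> corner 0" using UK(4) tail_subset_corner by blast
  qed auto
qed

lemma int_finite_upper: "finite A \<Longrightarrow> \<exists>N. \<forall>p\<in>A. f p < (N::int)"
  \<comment> \<open>The inserted 0 keeps \<open>Max\<close> meaningful for empty \<open>A\<close>;
    the added 1 makes the bound strict.\<close>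
  by (rule exI[of _ "Max (insert 0 (f ` A)) + 1"]) (auto intro!: zle_add1_eq_le[THEN iffD2])

text \<open>Far out, \<open>(k, k) \<in> K\<close> implies
  \<open>(k + 1, k + 1) \<in> W \<inter> U\<close> by the shift, so a single far-out
  \<open>(a, a) \<in> W\<close> starts an induction.\<close>

lemma idem_eventually:
  assumes "openin T U" "ebar \<in> U"
  shows "\<exists>N. \<forall>k\<ge>N. \<iota> (k, k) \<in> U"
proof -
  obtain W K where W: "openin T W" "compactin T K" "ebar \<in> W" "W \<subseteq> K" "K \<subseteq> corner 0"
    by (rule ebar_compact_nbhd)
  define shift where "shift x = \<iota> (1, 0) \<cdot> x \<cdot> \<iota> (0, 1)" for x
  have shift_ebar: "shift ebar = ebar"
  proof -
    have "shift ebar = ebar \<cdot> (\<iota> (1, 0) \<cdot> \<iota> (0, 1))"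
      unfolding shift_def by (simp add: ebar_central[symmetric] mult_assoc)
    then show ?thesis by (simp add: iota_mult ideal_iota_idem)
  qed
  have shift_iota: "shift (\<iota> (i, i)) = \<iota> (i + 1, i + 1)" if "0 \<le> i" for i
  proof -
    have "cz_mult (cz_mult (1, 0) (i, i)) (0, 1) = (i + 1, i + 1)"
      using that by (cases "0 < i") auto
    then show ?thesis unfolding shift_def iota_mult by simp
  qed
  define V where "V = W \<inter> U \<inter> {x \<in> topspace T. shift x \<in> W \<inter> U}"
  have V: "openin T V" unfolding V_def shift_def using assms W
    by (intro openin_Int openin_preimage continuous_intros_T iota_closed)
  have ebarV: "ebar \<in> V" using assms W by (simp add: V_def shift_ebar)
  \<comment> \<open>Among the idempotents, \<open>ebar\<close> is the only point of the ideal, so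
    \<open>V\<close> need contain no other point of it.\<close>
  define KE where "KE = K \<inter> {x \<in> topspace T. x \<cdot> x = x}"
  have "compactin T KE" unfolding KE_def
    by (intro compact_Int_closedin W closedin_equalizer continuous_intros_T)
  moreover have "KE \<inter> ideal \<subseteq> V" using ebarV idem_in_ideal_iff by (auto simp: KE_def)
  moreover have "KE \<subseteq> corner 0" using W by (auto simp: KE_def)
  ultimately have "finite {p. \<iota> p \<in> KE - V}" using compact_minus_open_finite V by blast
  then obtain N where "\<forall>p\<in>{p. \<iota> p \<in> KE - V}. fst p < N" using int_finite_upper by blast
  then have N: "\<iota> (k, k) \<in> V" if "\<iota> (k, k) \<in> K" "N \<le> k" for k
    using that by (fastforce simp: KE_def iota_mult)
  have "openin T ({x \<in> topspace T. x \<cdot> inv_elem x \<in> W} \<inter> tail N)"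
    by (intro openin_Int openin_preimage openin_tail W continuous_intros_T)
  moreover have "ebar \<in> {x \<in> topspace T. x \<cdot> inv_elem x \<in> W} \<inter> tail N"
    using W subsetD[OF ideal_subset_tail ebar_ideal] by (simp add: ideal_inverse)
  ultimately obtain a b where "\<iota> (a, b) \<in> {x \<in> topspace T. x \<cdot> inv_elem x \<in> W} \<inter> tail N"
    using open_meets_range_iota by blast
  then have a: "\<iota> (a, a) \<in> W" "N < a" by (simp_all add: iota_mult)
  have "\<iota> (k, k) \<in> W \<inter> U" if "a + 1 \<le> k" for k
    using that
  proof (induction k rule: int_ge_induct)
    case base
    have "\<iota> (a, a) \<in> V" using a W N by auto
    then have "shift (\<iota> (a, a)) \<in> W \<inter> U" by (simp add: V_def)
    \<comment> \<open>Nonnegativity matters: the shift sends every \<open>(i, i)\<close> with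
      \<open>i < 0\<close> to \<open>(1, 1)\<close>.\<close>
    moreover have "0 \<le> a" using a W iota_in_corner_iff by blast
    ultimately show ?case by (simp add: shift_iota)
  next
    case (step i)
    then have "\<iota> (i, i) \<in> V" using a W N[of i] by auto
    then have "shift (\<iota> (i, i)) \<in> W \<inter> U" by (simp add: V_def)
    moreover have "0 \<le> i" using step W iota_in_corner_iff by blast
    ultimately show ?case by (simp add: shift_iota)
  qed
  then show ?thesis by blast
qed

text \<open>The diagonal through \<open>(0, k)\<close> is the main one translated by
  \<open>(0, k)\<close>, exactly so from \<open>j = 0\<close> on.\<close>

lemma diagonal_eventually:
  assumes "openin T U" "pw k \<in> U"
  shows "\<exists>N. \<forall>j\<ge>N. \<iota> (j, j + k) \<in> U"
proof -
  have "openin T {x \<in> topspace T. x \<cdot> \<iota> (0, k) \<in> U}"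
    using assms by (intro openin_preimage continuous_intros_T iota_closed)
  moreover have "ebar \<in> {x \<in> topspace T. x \<cdot> \<iota> (0, k) \<in> U}"
    using assms by (simp add: ideal_mult_iota)
  ultimately obtain N where "\<forall>j\<ge>N. \<iota> (j, j) \<in> {x \<in> topspace T. x \<cdot> \<iota> (0, k) \<in> U}"
    using idem_eventually by blast
  then have "\<iota> (cz_mult (j, j) (0, k)) \<in> U" if "j \<ge> N" for j using that iota_mult by simp
  moreover have "cz_mult (j, j) (0, k) = (j, j + k)" if "j \<ge> 0" for j using that by auto
  ultimately have "\<forall>j\<ge>max N 0. \<iota> (j, j + k) \<in> U" by (metis max.bounded_iff)
  then show ?thesis by blast
qed

section \<open>Isolation of the unit and discreteness of the ideal\<close>

lemma pw_recurrent:
  assumes rec: "\<And>U. openin T U \<Longrightarrow> ebar \<in> U \<Longrightarrow> \<exists>n>0. pw n \<in> U"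
    and U: "openin T U" "ebar \<in> U"
  shows "\<exists>n\<ge>int N. pw n \<in> U"
  using U
proof (induction N arbitrary: U)
  case 0
  then show ?case using rec by (metis less_imp_le of_nat_0)
next
  case (Suc N)
  obtain n where n: "n > 0" "pw n \<in> U" using rec Suc.prems by blast
  \<comment> \<open>A return to this preimage followed by translation by \<open>(0, n)\<close> is a
    return to \<open>U\<close> with the exponent raised by \<open>n \<ge> 1\<close>.\<close>
  have "openin T {x \<in> topspace T. x \<cdot> \<iota> (0, n) \<in> U}"
    using Suc.prems by (intro openin_preimage continuous_intros_T iota_closed)
  moreover have "ebar \<in> {x \<in> topspace T. x \<cdot> \<iota> (0, n) \<in> U}"
    using n by (simp add: ideal_mult_iota)
  ultimately obtain l where "l \<ge> int N" "pw l \<in> {x \<in> topspace T. x \<cdot> \<iota> (0, n) \<in> U}"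
    using Suc.IH by blast
  then have "l + n \<ge> int (Suc N)" "pw (l + n) \<in> U"
    using n by (simp_all add: ideal_mult_iota pw_add)
  then show ?case by blast
qed

lemma ideal_translate_into:
  assumes rec: "\<And>U. openin T U \<Longrightarrow> ebar \<in> U \<Longrightarrow> \<exists>n>0. pw n \<in> U"
    and W: "openin T W" "ebar \<in> W" and y: "y \<in> ideal"
  shows "\<exists>n>0. y \<cdot> \<iota> (0, n) \<in> W"
proof -
  have "openin T {z \<in> topspace T. y \<cdot> z \<in> W}"
    using W y by (intro openin_preimage continuous_intros_T ideal_closed)
  moreover have "inv_elem y \<in> {z \<in> topspace T. y \<cdot> z \<in> W}"
    using W y by (simp add: ideal_inverse)
  ultimately obtain k where "pw k \<in> {z \<in> topspace T. y \<cdot> z \<in> W}"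
    using ideal_open_contains_pw inv_elem_ideal y by blast
  then have "ebar \<in> {x \<in> topspace T. y \<cdot> (x \<cdot> \<iota> (0, k)) \<in> W}" by (simp add: ideal_mult_iota)
  moreover have "openin T {x \<in> topspace T. y \<cdot> (x \<cdot> \<iota> (0, k)) \<in> W}"
    using W y by (intro openin_preimage continuous_intros_T ideal_closed iota_closed)
  \<comment> \<open>The exponent \<open>k\<close> may be negative; a return of the powers near
    \<open>ebar\<close> at \<open>n > \<bar>k\<bar>\<close> makes \<open>n + k\<close>
    positive.\<close>
  ultimately obtain n where n: "n \<ge> int (nat (\<bar>k\<bar> + 1))" "pw n \<in> {x \<in> topspace T. y \<cdot> (x \<cdot> \<iota> (0, k)) \<in> W}"
    using pw_recurrent[OF rec] by blast
  then have "n + k > 0" "y \<cdot> pw (n + k) \<in> W" by (simp_all add: ideal_mult_iota pw_add)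
  then show ?thesis using y by (intro exI[of _ "n + k"]) (simp add: ideal_mult_iota)
qed

lemma ebar_not_recurrent: "\<exists>U. openin T U \<and> ebar \<in> U \<and> (\<forall>n>0. pw n \<notin> U)"
proof (rule ccontr)
  assume "\<not> ?thesis"
  then have rec: "\<exists>n>0. pw n \<in> U" if "openin T U" "ebar \<in> U" for U using that by blast
  obtain W K where W: "openin T W" "compactin T K" "ebar \<in> W" "W \<subseteq> K" "K \<subseteq> corner 0"
    by (rule ebar_compact_nbhd)
  define V where "V = (\<Union>n\<in>{0<..}. {x \<in> topspace T. x \<cdot> \<iota> (0, n) \<in> W})"
  have "openin T {x \<in> topspace T. x \<cdot> \<iota> (0, n) \<in> W}" for n
    using W by (intro openin_preimage continuous_intros_T iota_closed)
  then have V: "openin T V" unfolding V_def by blast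
  have "ideal \<subseteq> V"
  proof
    fix y assume y: "y \<in> ideal"
    from ideal_translate_into[OF rec W(1,3) y] show "y \<in> V" using y by (auto simp: V_def)
  qed
  then have "finite {p. \<iota> p \<in> K - V}" using compact_minus_open_finite[OF W(2) V W(5)] by blast
  then obtain N where N: "\<forall>p\<in>{p. \<iota> p \<in> K - V}. fst p < N" using int_finite_upper by blast
  obtain N' where N': "\<forall>k\<ge>N'. \<iota> (k, k) \<in> W" using idem_eventually W by blast
  \<comment> \<open>With \<open>j \<ge> N\<close> every point of \<open>K\<close> in row
    \<open>j\<close> lies in \<open>V\<close>; with \<open>j \<ge> N'\<close> the row is
    nonempty.\<close>
  define j where "j = max N N'"
  define R where "R = {b. \<iota> (j, b) \<in> K}"
  \<comment> \<open>Row \<open>j\<close> avoids \<open>tail j\<close>, whose pairs have first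
    coordinate greater than \<open>j\<close>, so it meets \<open>K\<close> in a finite set.\<close>
  have "finite {p. \<iota> p \<in> K - tail j}"
    using compact_minus_open_finite[OF W(2) openin_tail W(5)] ideal_subset_tail by blast
  then have "finite (snd ` {p. \<iota> p \<in> K - tail j})" by (rule finite_imageI)
  moreover have "R \<subseteq> snd ` {p. \<iota> p \<in> K - tail j}" by (force simp: R_def)
  ultimately have R: "finite R" by (rule finite_subset[rotated])
  have "j \<in> R" using N' W by (auto simp: R_def j_def)
  then have "Max R \<in> R" using R by (intro Max_in) auto
  then have M: "\<iota> (j, Max R) \<in> K" by (simp add: R_def)
  then have "\<iota> (j, Max R) \<in> V" using N by (fastforce simp: j_def)
  then obtain n where n: "n > 0" "\<iota> (j, Max R) \<cdot> \<iota> (0, n) \<in> W" by (auto simp: V_def)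
  have "0 \<le> Max R" using M W(5) iota_in_corner_iff by blast
  then have "cz_mult (j, Max R) (0, n) = (j, Max R + n)" by auto
  then have "\<iota> (j, Max R + n) \<in> W" using n by (simp only: iota_mult)
  then have "Max R + n \<in> R" using W(4) by (auto simp: R_def)
  then show False using Max_ge[OF R] n(1) by fastforce
qed

lemma pw_inv_elem: "inv_elem (pw k) = pw (- k)"
  by (rule inv_elem_unique) (simp_all add: inverse_of_def pw_add)

text \<open>A neighbourhood without positive powers, made symmetric under inversion, has no power
  but \<open>ebar\<close>; by density of the powers it has no other point of the ideal.\<close>

lemma ebar_isolated:
  obtains U where "openin T U" "U \<inter> ideal = {ebar}"
proof -
  obtain U where U: "openin T U" "ebar \<in> U" "\<forall>n>0. pw n \<notin> U" using ebar_not_recurrent by blast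
  define V where "V = U \<inter> {x \<in> topspace T. inv_elem x \<in> U}"
  have V: "openin T V" unfolding V_def using U by (intro openin_Int openin_preimage continuous_intros_T)
  have pwV: "pw n \<notin> V" if "n \<noteq> 0" for n
    using that U(3) by (cases "n > 0") (auto simp: V_def pw_inv_elem)
  have "x = ebar" if x: "x \<in> V" "x \<in> ideal" for x
  proof (rule ccontr)
    assume "x \<noteq> ebar"
    then have "openin T (V - {ebar})" "x \<in> V - {ebar}"
      using V x closedin_singleton by (auto intro: openin_diff)
    then obtain k where "pw k \<in> V - {ebar}" using ideal_open_contains_pw x by blast
    then show False using pwV[of k] by (cases "k = 0") auto
  qed
  moreover have "ebar \<in> V" using U by (simp add: V_def inv_elem_idem)
  ultimately have "V \<inter> ideal = {ebar}" using ebar_ideal by blast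
  with V show ?thesis by (rule that)
qed

lemma pw_eq_ebar_iff: "pw k = ebar \<longleftrightarrow> k = 0"
proof
  assume k: "pw k = ebar"
  obtain U where U: "ebar \<in> U" "\<forall>n>0. pw n \<notin> U" using ebar_not_recurrent by blast
  have "pw (- k) = ebar" using k by (simp flip: pw_inv_elem add: inv_elem_idem)
  then show "k = 0" using U k by (metis linorder_neqE_linordered_idom neg_0_less_iff_less)
qed simp

lemma inj_pw: "pw k = pw l \<longleftrightarrow> k = l"
proof
  assume "pw k = pw l"
  then have "pw k \<cdot> pw (- l) = pw l \<cdot> pw (- l)" by simp
  then show "k = l" by (simp add: pw_add pw_eq_ebar_iff)
qed simp

text \<open>A power close enough to \<open>x\<close> has quotient \<open>ebar\<close> with
  \<open>x\<close>, since \<open>ebar\<close> is isolated in the ideal.\<close>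

lemma range_pw: "range pw = ideal"
proof
  show "ideal \<subseteq> range pw"
  proof
    fix x assume x: "x \<in> ideal"
    obtain U where U: "openin T U" "U \<inter> ideal = {ebar}" by (rule ebar_isolated)
    have "openin T {y \<in> topspace T. y \<cdot> inv_elem x \<in> U}"
      using U x by (intro openin_preimage continuous_intros_T inv_elem_closed ideal_closed)
    moreover have "x \<in> {y \<in> topspace T. y \<cdot> inv_elem x \<in> U}" using U x by (auto simp: ideal_inverse)
    ultimately obtain k where "pw k \<cdot> inv_elem x \<in> U" using ideal_open_contains_pw x by blast
    moreover have "pw k \<cdot> inv_elem x \<in> ideal" using x by (simp add: ideal_mult_right)
    ultimately have "pw k \<cdot> inv_elem x = ebar" using U(2) by blast
    then have "pw k \<cdot> (inv_elem x \<cdot> x) = ebar \<cdot> x" using x by (simp flip: mult_assoc)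
    then show "x \<in> range pw" using x by (auto simp: ideal_inverse)
  qed
qed auto

text \<open>Translation by \<open>pw (- k)\<close> sends exactly the diagonal
  \<open>b - a = k\<close>, together with \<open>pw k\<close>, to \<open>ebar\<close>; pull back the
  isolating neighbourhood.\<close>

lemma pw_nbhd:
  obtains U where "openin T U" "\<And>l. pw l \<in> U \<longleftrightarrow> l = k" "\<And>a b. \<iota> (a, b) \<in> U \<longleftrightarrow> b - a = k"
proof -
  obtain U where U: "openin T U" "U \<inter> ideal = {ebar}" by (rule ebar_isolated)
  have pwU: "pw l \<in> U \<longleftrightarrow> l = 0" for l
    using U(2) pw_ideal[of l] pw_eq_ebar_iff[of l] by blast
  show ?thesis
  proof
    show "openin T {x \<in> topspace T. x \<cdot> pw (- k) \<in> U}"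
      using U by (intro openin_preimage continuous_intros_T pw_closed)
    show "pw l \<in> {x \<in> topspace T. x \<cdot> pw (- k) \<in> U} \<longleftrightarrow> l = k" for l
      by (simp add: pw_add pwU)
    show "\<iota> (a, b) \<in> {x \<in> topspace T. x \<cdot> pw (- k) \<in> U} \<longleftrightarrow> b - a = k" for a b
      by (auto simp: iota_mult_pw pwU)
  qed
qed

section \<open>The isomorphisms with the integers and with \<open>tau3\<close>\<close>

lemma ideal_isomorphic_int:
  "topologically_isomorphic (subtopology T ideal) m (discrete_topology (UNIV :: int set)) (+)"
proof (rule topologically_isomorphicI)
  have sub: "ideal \<subseteq> topspace T" by auto
  show "homeomorphic_map (discrete_topology UNIV) (subtopology T ideal) pw"
  proof (rule bijective_open_imp_homeomorphic_map)
    show "open_map (discrete_topology UNIV) (subtopology T ideal) pw"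
      unfolding open_map_def
    proof (intro allI impI)
      fix A :: "int set"
      have "\<exists>V. openin (subtopology T ideal) V \<and> x \<in> V \<and> V \<subseteq> pw ` A" if x: "x \<in> pw ` A" for x
      proof -
        obtain k where k: "x = pw k" "k \<in> A" using x by blast
        obtain U where U: "openin T U" "\<And>l. pw l \<in> U \<longleftrightarrow> l = k"
          using pw_nbhd[of k] by metis
        have "U \<inter> ideal = {pw k}" using U(2) by (auto simp flip: range_pw)
        then show ?thesis using U(1) k openin_subtopology_Int[OF U(1), of ideal] by auto
      qed
      then show "openin (subtopology T ideal) (pw ` A)" by (subst openin_subopen) blast
    qed
  qed (use sub range_pw inj_pw in \<open>auto intro: injI\<close>)
qed (auto simp: semigroup_on_def pw_add)

definition S3_map :: "(int \<times> int) + int \<Rightarrow> 'a" where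
  "S3_map = case_sum \<iota> pw"

lemma S3_map_simps [simp]: "S3_map (Inl p) = \<iota> p" "S3_map (Inr k) = pw k"
  by (simp_all add: S3_map_def)

lemma range_S3_map: "range S3_map = range \<iota> \<union> ideal"
  unfolding S3_map_def range_pw[symmetric] by (auto simp: UNIV_sum image_Un image_image)

lemma S3_map_mult: "S3_map (s3_mult x y) = S3_map x \<cdot> S3_map y"
proof (cases x; cases y)
  fix n q assume "x = Inr n" "y = Inl q"
  then show ?thesis by (cases q) (simp add: ideal_mult_iota pw_add algebra_simps)
next
  fix p n assume "x = Inl p" "y = Inr n"
  then show ?thesis by (cases p) (simp add: iota_mult_pw)
qed (simp_all add: iota_mult pw_add)

lemma S3_isomorphic: "topologically_isomorphic (subtopology T (range \<iota> \<union> ideal)) m tau3 s3_mult"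
proof (rule topologically_isomorphicI)
  let ?S = "range \<iota> \<union> ideal"
  have sub: "?S \<subseteq> topspace T" by auto
  have inS: "S3_map x \<in> ?S" for x using range_S3_map by blast
  show "homeomorphic_map tau3 (subtopology T ?S) S3_map"
  proof (rule bijective_open_imp_homeomorphic_map)
    show "continuous_map tau3 (subtopology T ?S) S3_map"
      unfolding continuous_map_def
    proof (intro conjI allI impI)
      show "S3_map \<in> topspace tau3 \<rightarrow> topspace (subtopology T ?S)" using inS sub by auto
    next
      fix U assume "openin (subtopology T ?S) U"
      then obtain V where V: "openin T V" "U = V \<inter> ?S" by (auto simp: openin_subtopology)
      have "\<exists>n>0. s3_nbhd n k \<subseteq> {x \<in> topspace tau3. S3_map x \<in> U}" if k: "pw k \<in> V" for k
      proof -
        obtain N where N: "\<forall>j\<ge>N. \<iota> (j, j + k) \<in> V" using diagonal_eventually[OF V(1) k] by blast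
        \<comment> \<open>The index is positive, as \<open>tau3\<close> demands, and at least
          \<open>N\<close>.\<close>
        have "S3_map x \<in> V" if x: "x \<in> s3_nbhd (nat \<bar>N\<bar> + 1) k" for x
        proof (cases x)
          case (Inl p)
          then obtain a where "p = (a, a + k)" "N \<le> a" using x by (cases p) (auto simp: s3_nbhd_mem)
          then show ?thesis using Inl N by simp
        qed (use x k in \<open>simp add: s3_nbhd_mem\<close>)
        then show ?thesis using V inS by (intro exI[of _ "nat \<bar>N\<bar> + 1"]) (auto simp: topspace_tau3)
      qed
      then show "openin tau3 {x \<in> topspace tau3. S3_map x \<in> U}"
        unfolding openin_tau3_iff using V by simp
    qed
    show "open_map tau3 (subtopology T ?S) S3_map"
      unfolding open_map_def
    proof (intro allI impI)
      fix W assume W: "openin tau3 W"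
      have "\<exists>V. openin (subtopology T ?S) V \<and> S3_map x \<in> V \<and> V \<subseteq> S3_map ` W" if x: "x \<in> W" for x
      proof (cases x)
        case (Inl p)
        have "{\<iota> p} \<inter> ?S = {\<iota> p}" by blast
        then have "openin (subtopology T ?S) {\<iota> p}"
          using openin_subtopology_Int[OF openin_iota[of p], of ?S] by simp
        then show ?thesis using Inl x by (intro exI[of _ "{\<iota> p}"]) force
      next
        case (Inr k)
        then obtain n where n: "s3_nbhd n k \<subseteq> W" using W x openin_tau3_iff by blast
        obtain U where U: "openin T U" "\<And>l. pw l \<in> U \<longleftrightarrow> l = k" "\<And>a b. \<iota> (a, b) \<in> U \<longleftrightarrow> b - a = k"
          using pw_nbhd[of k] by metis
        \<comment> \<open>\<open>U\<close> selects the diagonal \<open>k\<close> and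
          \<open>tail\<close> its part beyond \<open>n\<close>, so everything in \<open>?V\<close>
          comes from \<open>s3_nbhd n k\<close>.\<close>
        let ?V = "(U \<inter> tail (int n)) \<inter> ?S"
        have "openin (subtopology T ?S) ?V"
          using U(1) openin_tail by (intro openin_subtopology_Int openin_Int)
        moreover have "S3_map x \<in> ?V"
          using Inr U(2) subsetD[OF ideal_subset_tail pw_ideal] by simp
        moreover have "?V \<subseteq> S3_map ` W"
        proof
          fix y assume y: "y \<in> ?V"
          then obtain z where z: "y = S3_map z" using range_S3_map by blast
          have "z \<in> s3_nbhd n k"
          proof (cases z)
            case (Inl p)
            then show ?thesis using y z U(3) by (cases p) (simp add: s3_nbhd_mem)
          next
            case (Inr l)
            then show ?thesis using y z U(2) by (simp add: s3_nbhd_mem)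
          qed
          then show "y \<in> S3_map ` W" using n z by blast
        qed
        ultimately show ?thesis by blast
      qed
      then show "openin (subtopology T ?S) (S3_map ` W)" by (subst openin_subopen) blast
    qed
    show "S3_map ` topspace tau3 = topspace (subtopology T ?S)"
      using sub by (simp add: topspace_tau3 range_S3_map Int_absorb1)
    have "\<iota> p \<noteq> pw k" "pw k \<noteq> \<iota> p" for p k using iota_notin_ideal pw_ideal by metis+
    then show "inj_on S3_map (topspace tau3)"
      by (auto intro!: injI simp: topspace_tau3 S3_map_def inj_pw split: sum.splits)
  qed
qed (simp_all add: semigroup_on_def topspace_tau3 s3_mult_assoc S3_map_mult)

section \<open>Compact semilattices and the natural homomorphism\<close>

lemma down_set_iota:
  "down_set (topspace T) m (\<iota> (n, n)) = insert ebar ((\<lambda>k. \<iota> (k, k)) ` {n..})"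
proof
  show "down_set (topspace T) m (\<iota> (n, n)) \<subseteq> insert ebar ((\<lambda>k. \<iota> (k, k)) ` {n..})"
  proof
    fix f assume "f \<in> down_set (topspace T) m (\<iota> (n, n))"
    then have f: "f \<in> topspace T" "f \<cdot> f = f" "f \<cdot> \<iota> (n, n) = f" "\<iota> (n, n) \<cdot> f = f"
      by (auto simp: down_set_def idempotents_def)
    \<comment> \<open>Being in the corner leaves only pairs and points of the ideal as candidates
      for \<open>f\<close>.\<close>
    then have "f \<in> corner n" by (simp add: corner_def)
    then consider "f \<in> ideal" | a b where "f = \<iota> (a, b)" using corner_subset by fast
    then show "f \<in> insert ebar ((\<lambda>k. \<iota> (k, k)) ` {n..})"
    proof cases
      case 1
      then show ?thesis using f(2) idem_in_ideal_iff by blast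
    next
      case 2
      have "\<iota> (cz_mult (a, b) (a, b)) = \<iota> (a, b)" using f(2) unfolding 2 iota_mult .
      then have "a = b" by (simp split: if_splits)
      moreover have "n \<le> a" using \<open>f \<in> corner n\<close> unfolding 2 by simp
      ultimately show ?thesis using 2 by auto
    qed
  qed
qed (auto simp: down_set_def idempotents_def iota_mult ideal_iota_idem)

text \<open>The set is the sequence of the \<open>(k, k)\<close> with its limit \<open>ebar\<close>:
  a member of the cover containing \<open>ebar\<close> misses only finitely many points.\<close>

lemma compactin_down_set: "compactin T (down_set (topspace T) m (\<iota> (n, n)))"
  unfolding compactin_def
proof (intro conjI allI impI)
  show "down_set (topspace T) m (\<iota> (n, n)) \<subseteq> topspace T" by (auto simp: down_set_iota)
next
  fix \<U> assume U: "Ball \<U> (openin T) \<and> down_set (topspace T) m (\<iota> (n, n)) \<subseteq> \<Union>\<U>"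
  then obtain V where V: "V \<in> \<U>" "ebar \<in> V" by (auto simp: down_set_iota)
  then obtain N where N: "\<forall>k\<ge>N. \<iota> (k, k) \<in> V" using U idem_eventually by blast
  have "compactin T ((\<lambda>k. \<iota> (k, k)) ` {n..N})" by (rule finite_imp_compactin) auto
  moreover have "(\<lambda>k. \<iota> (k, k)) ` {n..N} \<subseteq> \<Union>\<U>" using U by (auto simp: down_set_iota)
  ultimately obtain F where F: "finite F" "F \<subseteq> \<U>" "(\<lambda>k. \<iota> (k, k)) ` {n..N} \<subseteq> \<Union>F"
    using U unfolding compactin_def by meson
  have "\<iota> (k, k) \<in> \<Union>(insert V F)" if "n \<le> k" for k
  proof (cases "k \<le> N")
    case True
    with that have "\<iota> (k, k) \<in> (\<lambda>k. \<iota> (k, k)) ` {n..N}" by simp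
    with F(3) show ?thesis by blast
  qed (use N in auto)
  then have "down_set (topspace T) m (\<iota> (n, n)) \<subseteq> \<Union>(insert V F)"
    using V by (auto simp: down_set_iota)
  then show "\<exists>F. finite F \<and> F \<subseteq> \<U> \<and> down_set (topspace T) m (\<iota> (n, n)) \<subseteq> \<Union>F"
    using F(1,2) V(1) by (meson finite_insert insert_subset)
qed

lemma subsemilattice_down_set:
  "subsemilattice (down_set (topspace T) m (\<iota> (n, n))) (idempotents (topspace T) m) m"
  unfolding subsemilattice_def semilattice_on_def semigroup_on_def down_set_iota
  by (auto simp: idempotents_def iota_mult ideal_iota_idem)

text \<open>The value at \<open>(a, b)\<close> is \<open>pw (b - a)\<close>, and by
  \<open>C_mg_eq\<close> the congruence compares just these differences.\<close>

lemma natural_homomorphism_mult_ebar: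
  "natural_homomorphism UNIV cz_mult C_mg ideal m (\<lambda>p. \<iota> p \<cdot> ebar)"
  unfolding natural_homomorphism_def
proof (intro conjI ballI)
  have eq: "\<iota> p \<cdot> ebar = pw (snd p - fst p)" for p
    using iota_mult_ebar[of "fst p" "snd p"] by simp
  show "range (\<lambda>p. \<iota> p \<cdot> ebar) = ideal"
  proof
    have "pw k \<in> range (\<lambda>p. \<iota> p \<cdot> ebar)" for k
      by (rule range_eqI[of _ _ "(0, k)"]) (simp add: eq)
    then show "ideal \<subseteq> range (\<lambda>p. \<iota> p \<cdot> ebar)" by (auto simp flip: range_pw)
  qed (auto simp: eq)
  show "\<iota> (cz_mult x y) \<cdot> ebar = \<iota> x \<cdot> ebar \<cdot> (\<iota> y \<cdot> ebar)" for x y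
    by (cases x; cases y) (simp add: eq pw_add inj_pw)
  show "\<iota> x \<cdot> ebar = \<iota> y \<cdot> ebar \<longleftrightarrow> (x, y) \<in> C_mg" for x y
    by (cases x; cases y) (simp add: eq inj_pw C_mg_eq)
qed

end

theorem theorem4p7:
  fixes T :: "'a topology" and m :: "'a \<Rightarrow> 'a \<Rightarrow> 'a" and \<iota> :: "int \<times> int \<Rightarrow> 'a" and I :: "'a set"
  assumes "topological_inverse_semigroup T m"
    and "Hausdorff_space T"
    and "locally_compact_space T"
    and "dense_cz_subsemigroup T m \<iota>"
    and "I = topspace T - up_cz (topspace T) m \<iota>"
    and "I \<noteq> {}"
  shows
    "(\<forall>n::int.
        subsemilattice (down_set (topspace T) m (\<iota> (n, n))) (idempotents (topspace T) m) m \<and>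
        compactin (subtopology T (idempotents (topspace T) m)) (down_set (topspace T) m (\<iota> (n, n)))) \<and>
     topologically_isomorphic (subtopology T I) m (discrete_topology (UNIV :: int set)) (+) \<and>
     (\<forall>e. identity_on I m e \<longrightarrow>
        natural_homomorphism UNIV cz_mult C_mg I m (\<lambda>p. m (\<iota> p) e)) \<and>
     topologically_isomorphic (subtopology T (range \<iota> \<union> I)) m tau3 s3_mult"
proof -
  interpret D: cz_dense T m \<iota> by unfold_locales fact+
  have I: "I = D.ideal" using assms(5) by (simp add: D.ideal_def)
  interpret cz_closure T m \<iota> using assms(3,6) I by unfold_locales auto
  \<comment> \<open>A unit of the ideal is idempotent, so it is the chosen
    \<open>ebar\<close>.\<close>
  have "e = ebar" if "identity_on I m e" for e
    using that idem_in_ideal_iff[of e] unfolding identity_on_def I by simp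
  moreover have "down_set (topspace T) m (\<iota> (n, n)) \<subseteq> idempotents (topspace T) m" for n
    by (auto simp: down_set_def)
  ultimately show ?thesis
    unfolding I compactin_subtopology
    using compactin_down_set subsemilattice_down_set ideal_isomorphic_int
      natural_homomorphism_mult_ebar S3_isomorphic by blast
qed

end
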